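(* Let $\mathbb{G}$ be a homogeneous group of homogeneous dimension $Q\geq 3$ and let $|\cdot|$ be an arbitrary homogeneous quasi-norm on $\mathbb{G}$. Let $\phi,\psi\in L^{2}_{loc}(\mathbb{G}\backslash\{0\})$ be any real-valued functions such that $\mathcal{R}\phi,\mathcal{R}\psi\in L^{2}_{loc}(\mathbb{G}\backslash\{0\})$, where $\mathcal{R}=\frac{d}{d|x|}$ is the radial derivative. Let $\alpha\in\mathbb{R}$. Then for all complex-valued functions $f\in C_{0}^{\infty}(\mathbb{G}\backslash\{0\})$ we have $$\int_{\mathbb{G}}(\phi(x))^{2}|\mathcal{R} f(x)|^{2}dx\geq \alpha \int_{\mathbb{G}}\left(\phi(x)\mathcal{R} \psi(x)+\psi(x) \mathcal{R} \phi(x)\right)|f(x)|^{2}dx+\alpha(Q-1)\int_{\mathbb{G}}\frac{\phi(x)\psi(x)}{|x|}|f(x)|^{2}dx-\alpha^{2}\int_{\mathbb{G}}(\psi(x))^{2}|f(x)|^{2}dx$$ and $$\int_{\mathbb{G}}(\phi(x))^{2}|\mathcal{R} f(x)|^{2}dx\geq \alpha \int_{\mathbb{G}}\left(\psi(x) \mathcal{R} \phi(x)-\phi(x)\mathcal{R} \psi(x)\right)|f(x)|^{2}dx+\alpha(Q-1)\int_{\mathbb{G}}\frac{\phi(x)\psi(x)}{|x|}|f(x)|^{2}dx-\alpha^{2}\int_{\mathbb{G}}(\psi(x))^{2}|f(x)|^{2}dx$$ $$-(Q-1)\int_{\mathbb{G}}\frac{(\phi(x))^{2}}{|x|^{2}}|f(x)|^{2}dx+(Q-1)\int_{\mathbb{G}}\frac{\phi(x)\mathcal{R}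 \phi(x)}{|x|}|f(x)|^{2}dx+\int_{\mathbb{G}}\phi(x)\mathcal{R}^{2}\phi(x)|f(x)|^{2}dx.$$
   Context: A homogeneous group is a connected simply connected Lie group $\mathbb{G}$ whose Lie algebra $\mathfrak{g}$ is equipped with a family of dilations $D_{\lambda}=\mathrm{Exp}(A\ln\lambda)=\sum_{k\ge 0}\frac{1}{k!}(\ln(\lambda)A)^k$, $\lambda>0$, where $A$ is a diagonalisable positive linear operator on $\mathfrak{g}$ and each $D_\lambda$ is a Lie algebra morphism: $[D_\lambda X,D_\lambda Y]=D_\lambda[X,Y]$. Via the exponential map the dilations act on $\mathbb{G}$; write $\lambda x$ for $D_\lambda x$, and $0$ for the identity element. The homogeneous dimension is $Q=\mathrm{Tr}\,A$. $dx$ is the Haar measure on $\mathbb{G}$ (the Lebesgue measure in exponential coordinates), and $\int_{\mathbb{G}}f(\lambda x)dx=\lambda^{-Q}\int_{\mathbb{G}}f(x)dx$. A homogeneous quasi-norm is a continuous function $|\cdot|:\mathbb{G}\to[0,\infty)$ with $|x^{-1}|=|x|$, $|\lambda x|=\lambda|x|$ for $\lambda>0$, and $|x|=0$ iff $x=0$ (the triangle inequality may hold only with a constant $\ge1$). Polar decomposition: with $\mathfrak{S}=\{x\in\mathbb{G}:|x|=1\}$, there is a positive Borel measure $\sigma$ on $\mathfrak{S}$ such that $\int_{\mathbb{G}}f(x)dx=\int_{0}^{\infty}\int_{\mathfrak{S}}f(ry)r^{Q-1}d\sigma(y)dr$ for all $f\in L^1(\mathbb{G})$. Radial derivative: writing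 $x=ry$ with $r=|x|$ and $y\in\mathfrak{S}$, $\mathcal{R}f(x)=\frac{d}{d|x|}f(x)=\frac{d}{dr}\big(f(ry)\big)$, and $\mathcal{R}^2=\mathcal{R}\circ\mathcal{R}$ is the second radial derivative. $C_0^\infty(\mathbb{G}\backslash\{0\})$ denotes the smooth functions compactly supported in $\mathbb{G}\backslash\{0\}$, and $L^2_{loc}(\mathbb{G}\backslash\{0\})$ the functions that are locally square integrable on $\mathbb{G}\backslash\{0\}$. *)

theory Defs
  imports "HOL-Analysis.Analysis" "HOL-Algebra.Group"
begin

section \<open>Smooth functions\<close>

text \<open>Intended for open \<open>S\<close>: all iterated directional Frechet derivatives up to order \<open>k\<close> exist
  on \<open>S\<close> and are continuous there.\<close>

primrec Ck_on :: "nat \<Rightarrow> ('a::real_normed_vector \<Rightarrow> 'b::real_normed_vector) \<Rightarrow> 'a set \<Rightarrow> bool" where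
  "Ck_on 0 f S \<longleftrightarrow> continuous_on S f"
| "Ck_on (Suc k) f S \<longleftrightarrow>
     f differentiable_on S \<and> (\<forall>v. Ck_on k (\<lambda>x. frechet_derivative f (at x) v) S)"

definition smooth_on :: "('a::real_normed_vector \<Rightarrow> 'b::real_normed_vector) \<Rightarrow> 'a set \<Rightarrow> bool" where
  "smooth_on f S \<longleftrightarrow> (\<forall>k. Ck_on k f S)"

section \<open>Homogeneous groups\<close>

text \<open>The exponential map of a homogeneous group is a global diffeomorphism from the Lie algebra,
  and the group is identified with its Lie algebra through it. A connected simply connected Lie
  group in such global exponential coordinates is a smooth group law on \<open>real ^ 'n\<close> with identity
  \<open>0\<close> whose one-parameter subgroups are the lines \<open>t \<mapsto> t X\<close>, that is, \<open>exp\<close> is the identity map.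
  Haar measure is then Lebesgue measure.\<close>

locale exp_coord_Lie_group =
  fixes G :: "(real ^ 'n::finite) monoid"
  assumes group: "Group.group G"
    and carrier: "carrier G = UNIV"
    and one: "\<one>\<^bsub>G\<^esub> = 0"
    and smooth_mult: "smooth_on (\<lambda>(x, y). x \<otimes>\<^bsub>G\<^esub> y) UNIV"
    and smooth_inv: "smooth_on (\<lambda>x. inv\<^bsub>G\<^esub> x) UNIV"
    and one_param: "(s *\<^sub>R X) \<otimes>\<^bsub>G\<^esub> (t *\<^sub>R X) = (s + t) *\<^sub>R X"

text \<open>\<open>Ad(g) Y\<close> is the velocity at \<open>0\<close> of \<open>t \<mapsto> g exp(tY) g\<^sup>-\<^sup>1\<close>, and \<open>[X, Y]\<close> is the derivative at
  \<open>s = 0\<close> of \<open>Ad(exp(sX)) Y\<close>; here \<open>exp\<close> is the identity map.\<close>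

definition Lie_Ad :: "(real ^ 'n::finite) monoid \<Rightarrow> real ^ 'n \<Rightarrow> real ^ 'n \<Rightarrow> real ^ 'n" where
  "Lie_Ad G g Y =
     vector_derivative (\<lambda>t. g \<otimes>\<^bsub>G\<^esub> (t *\<^sub>R Y) \<otimes>\<^bsub>G\<^esub> inv\<^bsub>G\<^esub> g) (at (0::real))"

definition Lie_bracket :: "(real ^ 'n::finite) monoid \<Rightarrow> real ^ 'n \<Rightarrow> real ^ 'n \<Rightarrow> real ^ 'n" where
  "Lie_bracket G X Y = vector_derivative (\<lambda>s. Lie_Ad G (s *\<^sub>R X) Y) (at (0::real))"

definition diagonalisable_positive :: "(real ^ 'n::finite \<Rightarrow> real ^ 'n) \<Rightarrow> bool" where
  "diagonalisable_positive A \<longleftrightarrow>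
     (\<exists>B. independent B \<and> span B = UNIV \<and> (\<forall>b\<in>B. \<exists>\<nu>>0. A b = \<nu> *\<^sub>R b))"

definition dilation :: "(real ^ 'n::finite \<Rightarrow> real ^ 'n) \<Rightarrow> real \<Rightarrow> real ^ 'n \<Rightarrow> real ^ 'n" where
  "dilation A lam x = (\<Sum>k. ((ln lam) ^ k / fact k) *\<^sub>R (A ^^ k) x)"

locale homogeneous_group = exp_coord_Lie_group G
  for G :: "(real ^ 'n::finite) monoid" +
  fixes A :: "real ^ 'n \<Rightarrow> real ^ 'n"
  assumes linear: "linear A"
    and diagonalisable_positive: "diagonalisable_positive A"
    and dilation_morphism: "lam > 0 \<Longrightarrow>
      Lie_bracket G (dilation A lam X) (dilation A lam Y) = dilation A lam (Lie_bracket G X Y)"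

definition homogeneous_dim :: "(real ^ 'n::finite \<Rightarrow> real ^ 'n) \<Rightarrow> real" where
  "homogeneous_dim A = trace (matrix A)"

definition homogeneous_quasi_norm ::
  "(real ^ 'n::finite) monoid \<Rightarrow> (real ^ 'n \<Rightarrow> real ^ 'n) \<Rightarrow> (real ^ 'n \<Rightarrow> real) \<Rightarrow> bool" where
  "homogeneous_quasi_norm G A N \<longleftrightarrow>
     continuous_on UNIV N \<and> (\<forall>x. N x \<ge> 0) \<and>
     (\<forall>x. N (inv\<^bsub>G\<^esub> x) = N x) \<and>
     (\<forall>lam>0. \<forall>x. N (dilation A lam x) = lam * N x) \<and>
     (\<forall>x. N x = 0 \<longleftrightarrow> x = 0)"

section \<open>Function spaces on the punctured group\<close>

text \<open>Elements of \<open>C\<^sub>0\<^sup>\<infinity>(G - {0})\<close>, extended by zero to the identity element.\<close>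

definition test_function :: "(real ^ 'n::finite \<Rightarrow> 'b::real_normed_vector) \<Rightarrow> bool" where
  "test_function f \<longleftrightarrow> smooth_on f (- {0}) \<and>
     compact (closure {x. f x \<noteq> 0}) \<and> closure {x. f x \<noteq> 0} \<subseteq> - {0}"

definition L1_loc :: "(real ^ 'n::finite \<Rightarrow> real) \<Rightarrow> bool" where
  "L1_loc g \<longleftrightarrow> g \<in> borel_measurable (lebesgue_on (- {0})) \<and>
     (\<forall>K. compact K \<and> K \<subseteq> - {0} \<longrightarrow> set_integrable lebesgue K g)"

definition L2_loc :: "(real ^ 'n::finite \<Rightarrow> real) \<Rightarrow> bool" where
  "L2_loc g \<longleftrightarrow> g \<in> borel_measurable (lebesgue_on (- {0})) \<and>
     (\<forall>K. compact K \<and> K \<subseteq> - {0} \<longrightarrow> set_integrable lebesgue K (\<lambda>x. (g x)\<^sup>2))"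

section \<open>The radial derivative\<close>

text \<open>The pointwise derivative \<open>d/dr f(ry)\<close> at \<open>r = |x|\<close>, where \<open>y = |x|\<^sup>-\<^sup>1 x\<close> lies on the unit
  quasi-sphere.\<close>

definition radial_deriv ::
  "(real ^ 'n::finite \<Rightarrow> real ^ 'n) \<Rightarrow> (real ^ 'n \<Rightarrow> real) \<Rightarrow>
   (real ^ 'n \<Rightarrow> 'b::real_normed_vector) \<Rightarrow> real ^ 'n \<Rightarrow> 'b" where
  "radial_deriv A N f x =
     vector_derivative (\<lambda>r. f (dilation A r (dilation A (1 / N x) x))) (at (N x))"

text \<open>For locally integrable functions the radial derivative is the weak one. By the polar
  decomposition, where \<open>dx\<close> becomes \<open>r\<^bsup>Q-1\<^esup> d\<sigma>(y) dr\<close>, the formal adjoint of \<open>R\<close> is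
  \<open>- R - (Q - 1) / |x|\<close>.\<close>

definition radial_adjoint ::
  "(real ^ 'n::finite \<Rightarrow> real ^ 'n) \<Rightarrow> (real ^ 'n \<Rightarrow> real) \<Rightarrow> (real ^ 'n \<Rightarrow> real) \<Rightarrow> real ^ 'n \<Rightarrow> real" where
  "radial_adjoint A N \<eta> x = - radial_deriv A N \<eta> x - (homogeneous_dim A - 1) / N x * \<eta> x"

definition has_weak_radial_deriv ::
  "(real ^ 'n::finite \<Rightarrow> real ^ 'n) \<Rightarrow> (real ^ 'n \<Rightarrow> real) \<Rightarrow>
   (real ^ 'n \<Rightarrow> real) \<Rightarrow> (real ^ 'n \<Rightarrow> real) \<Rightarrow> bool" where
  "has_weak_radial_deriv A N u v \<longleftrightarrow> L1_loc u \<and> L1_loc v \<and>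
     (\<forall>\<eta>. test_function \<eta> \<longrightarrow>
        (LINT x|lebesgue. v x * \<eta> x) = (LINT x|lebesgue. u x * radial_adjoint A N \<eta> x))"

text \<open>The value of \<open>\<integral> u (R v) \<eta> dx\<close> for a test function \<open>\<eta>\<close>, where \<open>u\<close>, its radial derivative
  \<open>Ru\<close> and \<open>v\<close> lie in \<open>L\<^sup>2\<close> locally. If \<open>R v\<close> is a function and the integrand is integrable, this
  is the Lebesgue integral. Otherwise \<open>R v\<close> is only a distribution, and the product
  \<open>u (R v) = R (u v) - (Ru) v\<close> is paired with \<open>\<eta>\<close>.\<close>

definition radial_pairing ::
  "(real ^ 'n::finite \<Rightarrow> real ^ 'n) \<Rightarrow> (real ^ 'n \<Rightarrow> real) \<Rightarrow> (real ^ 'n \<Rightarrow> real) \<Rightarrow>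
   (real ^ 'n \<Rightarrow> real) \<Rightarrow> (real ^ 'n \<Rightarrow> real) \<Rightarrow> (real ^ 'n \<Rightarrow> real) \<Rightarrow> real" where
  "radial_pairing A N u Ru v \<eta> =
     (let P = (\<lambda>Rv. has_weak_radial_deriv A N v Rv \<and> integrable lebesgue (\<lambda>x. u x * Rv x * \<eta> x))
      in if \<exists>Rv. P Rv then (LINT x|lebesgue. u x * (SOME Rv. P Rv) x * \<eta> x)
         else (LINT x|lebesgue. u x * v x * radial_adjoint A N \<eta> x)
              - (LINT x|lebesgue. Ru x * v x * \<eta> x))"

end

theory Submission
  imports Defs
begin

text \<open>Both inequalities come from expanding a square. With \<open>E\<close> the generator of the dilations
\<open>\<Phi>\<^sub>s = D\<^bsub>exp s\<^esub>\<close>, the radial derivative is \<open>R = E / |x|\<close>. The first inequality is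
\<open>0 \<le> \<integral> |\<phi> Rf + \<alpha> \<psi> f|\<^sup>2\<close>; the second is \<open>0 \<le> \<integral> |\<phi> Rf - k f|\<^sup>2\<close> with
\<open>k = \<alpha> \<psi> - R\<phi> - (Q - 1) \<phi> / |x|\<close>, which makes \<open>- \<phi> Rf + k f\<close> the formal adjoint of
\<open>\<phi> R + \<alpha> \<psi>\<close> applied to \<open>f\<close>. The cross terms contain \<open>R |f|\<^sup>2\<close> and are integrated by parts.

What has to be proved is therefore the integration by parts: for functions \<open>u, v\<close> that only have weak
radial derivatives \<open>u', v'\<close>, and for \<open>j = 0, 1\<close>,
\<open>\<integral> |x|\<^bsup>-j\<^esup> ((u' v + u v') |f|\<^sup>2 + u v (R |f|\<^sup>2 + (Q - 1 - j) |f|\<^sup>2 / |x|)) dx = 0\<close>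
(\<open>weighted_product_rule\<close>). The weight \<open>|x|\<^sup>-\<^sup>1\<close> is needed for the term \<open>(Q - 1) \<phi>\<^sup>2 R |f|\<^sup>2 / |x|\<close> of
the second square; \<open>|f|\<^sup>2 / |x|\<close> cannot serve as a test function there, because the quasi-norm is merely
continuous. The same rule with \<open>u = \<phi>\<close> and \<open>v = R\<phi>\<close> evaluates the term with the second radial
derivative of \<open>\<phi>\<close>, whether that derivative is a function or only a distribution. In the first case
\<open>\<phi> R(R\<phi>) |f|\<^sup>2\<close> is known to be integrable but \<open>R(R\<phi>)\<close> is merely locally integrable, so approximation
in \<open>L\<^sup>2\<close> is of no use and the rule is proved one orbit of the dilations at a time.

The argument on orbits is this. Let \<open>h\<close> be a real test function; the real and imaginary parts of \<open>f\<close>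
are used. The function \<open>u / |x|\<close> has a weak derivative along the smooth linear vector field
\<open>E\<close>, and this moves the rough factor \<open>1 / |x|\<close> from the test function to \<open>u\<close>. Testing with \<open>h\<close> times
polynomials shows that \<open>U = h u / |x|\<close> is weakly differentiable along \<open>E\<close> with a derivative \<open>W\<close>
(\<open>localized_weak_deriv\<close>). Inserting the polynomials \<open>p \<circ> \<Phi>\<^bsub>-t\<^esub>\<close>, integrating over \<open>t\<close>
and using the density of polynomials yields the integrated form of this statement along the flow
(\<open>transport_along_flow\<close>); hence on almost every orbit \<open>U\<close> is the primitive of \<open>W\<close>
(\<open>orbit_primitive\<close>). Two primitives satisfy the product rule by Fubini's theorem
(\<open>integral_mult_primitives\<close>), and polar coordinates turn the vanishing of the integrals over almost
all orbits into the vanishing of the integral over the group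
(\<open>integral_eq_0_if_orbit_integrals_eq_0\<close>).

Only test functions obtained by multiplying parts of the given \<open>f\<close> with polynomials occur, so no bump
functions have to be constructed, and the sphere measure is replaced by the annulus
\<open>1 \<le> |x| \<le> e\<close>, which every orbit except that of 0 crosses in one unit of time.\<close>

section \<open>Calculus of smooth and test functions\<close>

lemma Ck_on_cong:
  assumes "open S" "Ck_on k f S" "\<And>x. x \<in> S \<Longrightarrow> f x = g x"
  shows "Ck_on k g S"
  using assms(2,3)
proof (induction k arbitrary: f g)
  case 0
  then show ?case by (simp cong: continuous_on_cong)
next
  case (Suc k)
  have "Ck_on k (\<lambda>x. frechet_derivative g (at x) v) S" for v
  proof (rule Suc.IH)
    show "Ck_on k (\<lambda>x. frechet_derivative f (at x) v) S" using Suc.prems by simp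
    fix x assume x: "x \<in> S"
    have "f differentiable at x"
      using Suc.prems(1) x \<open>open S\<close> by (simp add: differentiable_on_eq_differentiable_at)
    then show "frechet_derivative f (at x) v = frechet_derivative g (at x) v"
      using frechet_derivative_transform_within_open[OF _ \<open>open S\<close> x Suc.prems(2)] by simp
  qed
  moreover have "g differentiable_on S"
    using Suc.prems by (simp add: differentiable_on_def)
      (metis differentiable_transform_within zero_less_one)
  ultimately show ?case by simp
qed

lemma Ck_on_differentiable_at:
  "\<lbrakk>Ck_on (Suc k) f S; open S; x \<in> S\<rbrakk> \<Longrightarrow> f differentiable at x"
  by (simp add: differentiable_on_eq_differentiable_at)

text \<open>Any derivative found by hand may be used instead of \<open>frechet_derivative\<close>.\<close>

lemma Ck_on_SucI:
  assumes "open S" "\<And>x. x \<in> S \<Longrightarrow> (f has_derivative f' x) (at x)" "\<And>v. Ck_on k (\<lambda>x. f' x v) S"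
  shows "Ck_on (Suc k) f S"
proof -
  have "f differentiable_on S"
    using assms by (auto simp: differentiable_on_eq_differentiable_at differentiable_def)
  moreover have "Ck_on k (\<lambda>x. frechet_derivative f (at x) v) S" for v
    using assms by (intro Ck_on_cong[OF assms(1) assms(3)[of v]]) (metis frechet_derivative_at)
  ultimately show ?thesis by simp
qed

lemma Ck_on_const: "Ck_on k (\<lambda>x. c) S"
  by (induction k arbitrary: c) auto

lemma Ck_on_Suc_imp: "Ck_on (Suc k) f S \<Longrightarrow> Ck_on k f S"
proof (induction k arbitrary: f)
  case 0
  then show ?case using differentiable_imp_continuous_on by auto
next
  case (Suc k)
  have "f differentiable_on S" "\<And>v. Ck_on (Suc k) (\<lambda>x. frechet_derivative f (at x) v) S"
    using Suc.prems by (simp_all only: Ck_on.simps(2)[of "Suc k"])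
  then show ?case
    using Suc.IH by (simp only: Ck_on.simps(2)[of k]) blast
qed

lemma Ck_on_add:
  assumes "open S" "Ck_on k f S" "Ck_on k g S"
  shows "Ck_on k (\<lambda>x. f x + g x) S"
  using assms(2,3)
proof (induction k arbitrary: f g)
  case (Suc k)
  show ?case
  proof (rule Ck_on_SucI[OF assms(1)])
    fix x assume "x \<in> S"
    then show "((\<lambda>x. f x + g x) has_derivative
        (\<lambda>v. frechet_derivative f (at x) v + frechet_derivative g (at x) v)) (at x)"
      using Ck_on_differentiable_at[OF Suc.prems(1) assms(1)] Ck_on_differentiable_at[OF Suc.prems(2) assms(1)]
      by (intro has_derivative_add) (auto simp: frechet_derivative_works[symmetric])
  next
    show "Ck_on k (\<lambda>x. frechet_derivative f (at x) v + frechet_derivative g (at x) v) S" for v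
      using Suc by simp
  qed
qed (auto intro: continuous_intros)

lemma (in bounded_linear) Ck_on_compose:
  assumes "open S" "Ck_on k g S"
  shows "Ck_on k (\<lambda>x. f (g x)) S"
  using assms(2)
proof (induction k arbitrary: g)
  case 0
  then show ?case by (simp add: continuous_on)
next
  case (Suc k)
  show ?case
  proof (rule Ck_on_SucI[OF assms(1)])
    fix x assume "x \<in> S"
    then show "((\<lambda>x. f (g x)) has_derivative (\<lambda>v. f (frechet_derivative g (at x) v))) (at x)"
      using Ck_on_differentiable_at[OF Suc.prems(1) assms(1)]
      by (intro has_derivative) (auto simp: frechet_derivative_works[symmetric])
  next
    show "Ck_on k (\<lambda>x. f (frechet_derivative g (at x) v)) S" for v
      using Suc by simp
  qed
qed

lemma (in bounded_bilinear) Ck_on_prod: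
  assumes "open S" "Ck_on k f S" "Ck_on k g S"
  shows "Ck_on k (\<lambda>x. prod (f x) (g x)) S"
  using assms(2,3)
proof (induction k arbitrary: f g)
  case 0
  then show ?case by (simp add: continuous_on)
next
  case (Suc k)
  show ?case
  proof (rule Ck_on_SucI[OF assms(1)])
    fix x assume "x \<in> S"
    then show "((\<lambda>x. prod (f x) (g x)) has_derivative
        (\<lambda>v. prod (f x) (frechet_derivative g (at x) v) + prod (frechet_derivative f (at x) v) (g x))) (at x)"
      using Ck_on_differentiable_at[OF Suc.prems(1) assms(1)] Ck_on_differentiable_at[OF Suc.prems(2) assms(1)]
      by (intro FDERIV) (auto simp: frechet_derivative_works[symmetric])
  next
    show "Ck_on k (\<lambda>x. prod (f x) (frechet_derivative g (at x) v)
        + prod (frechet_derivative f (at x) v) (g x)) S" for v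
      using Suc Ck_on_Suc_imp[OF Suc.prems(1)] Ck_on_Suc_imp[OF Suc.prems(2)]
      by (intro Ck_on_add[OF assms(1)]) simp_all
  qed
qed

lemma Ck_on_real_polynomial_function:
  assumes "real_polynomial_function p" "open S"
  shows "Ck_on k p S"
  using assms(1)
proof (induction arbitrary: k)
  case (linear f)
  show ?case
  proof (cases k)
    case 0
    then show ?thesis by (simp add: linear linear_continuous_on)
  next
    case (Suc j)
    then show ?thesis
      by (auto intro!: Ck_on_SucI[OF assms(2), where f' = "\<lambda>_. f"] Ck_on_const
        simp: linear bounded_linear.has_derivative bounded_linear_imp_has_derivative simp del: Ck_on.simps)
  qed
next
  case (const c)
  show ?case by (rule Ck_on_const)
next
  case (add f g)
  then show ?case by (intro Ck_on_add[OF assms(2)]) auto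
next
  case (mult f g)
  then show ?case by (intro bounded_bilinear.Ck_on_prod[OF bounded_bilinear_mult assms(2)]) auto
qed

lemma test_function_mult_polynomial:
  fixes h :: "real ^ 'n::finite \<Rightarrow> real"
  assumes h: "test_function h" and p: "real_polynomial_function p"
  shows "test_function (\<lambda>x. h x * p x)"
proof -
  have sub: "closure {x. h x * p x \<noteq> 0} \<subseteq> closure {x. h x \<noteq> 0}"
    by (rule closure_mono) auto
  have "compact (closure {x. h x * p x \<noteq> 0})"
    using compact_Int_closed[of "closure {x. h x \<noteq> 0}" "closure {x. h x * p x \<noteq> 0}"] h sub
    by (simp add: test_function_def inf_absorb2)
  moreover have "Ck_on k p (- {0})" for k
    using Ck_on_real_polynomial_function[OF p] by (simp add: open_Compl)
  then have "smooth_on (\<lambda>x. h x * p x) (- {0})"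
    using h unfolding smooth_on_def test_function_def
    by (auto intro!: bounded_bilinear.Ck_on_prod[OF bounded_bilinear_mult])
  ultimately show ?thesis
    using h sub by (auto simp: test_function_def)
qed

lemma test_function_bounded_linear:
  assumes L: "bounded_linear L" and f: "test_function f"
  shows "test_function (\<lambda>x. L (f x))"
proof -
  interpret bounded_linear L by fact
  have sub: "closure {x. L (f x) \<noteq> 0} \<subseteq> closure {x. f x \<noteq> 0}"
    by (rule closure_mono) (auto simp: zero)
  have "compact (closure {x. L (f x) \<noteq> 0})"
    using compact_Int_closed[of "closure {x. f x \<noteq> 0}" "closure {x. L (f x) \<noteq> 0}"] f sub
    by (simp add: test_function_def inf_absorb2)
  moreover have "smooth_on (\<lambda>x. L (f x)) (- {0})"
    using f unfolding smooth_on_def test_function_def by (auto intro!: Ck_on_compose)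
  ultimately show ?thesis
    using f sub by (auto simp: test_function_def)
qed

text \<open>Since a test function vanishes near 0, it is differentiable on the whole space.\<close>

lemma test_function_differentiable:
  assumes f: "test_function f"
  shows "f differentiable at x"
proof (cases "x = 0")
  case False
  have "Ck_on (Suc 0) f (- {0})"
    using f unfolding test_function_def smooth_on_def by blast
  then show ?thesis
    using False by (intro Ck_on_differentiable_at) (auto simp del: Ck_on.simps)
next
  case True
  have z: "f y = 0" if "y \<notin> closure {x. f x \<noteq> 0}" for y
    using closure_subset[of "{x. f x \<noteq> 0}"] that by blast
  let ?S = "- closure {x. f x \<noteq> 0}"
  have "(f has_derivative (\<lambda>_. 0)) (at x)"
  proof (rule has_derivative_transform_within_open[OF has_derivative_const])
    show "x \<in> ?S" using True f by (auto simp: test_function_def)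
    show "open ?S" by (intro open_Compl closed_closure)
    show "\<And>y. y \<in> ?S \<Longrightarrow> 0 = f y" using z by (metis ComplD)
  qed
  then show ?thesis by (auto simp: differentiable_def)
qed

lemma test_function_frechet_derivative_outside:
  assumes f: "test_function f" and x: "x \<notin> closure {x. f x \<noteq> 0}"
  shows "frechet_derivative f (at x) v = 0"
proof -
  have z: "f y = 0" if "y \<notin> closure {x. f x \<noteq> 0}" for y
    using closure_subset[of "{x. f x \<noteq> 0}"] that by blast
  let ?S = "- closure {x. f x \<noteq> 0}"
  have "(f has_derivative (\<lambda>_. 0)) (at x)"
  proof (rule has_derivative_transform_within_open[OF has_derivative_const])
    show "x \<in> ?S" using x f by (auto simp: test_function_def)
    show "open ?S" by (intro open_Compl closed_closure)
    show "\<And>y. y \<in> ?S \<Longrightarrow> 0 = f y" using z by (metis ComplD)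
  qed
  then show ?thesis by (metis frechet_derivative_at)
qed

lemma test_function_frechet_derivative_continuous:
  assumes f: "test_function (f :: real ^ 'n::finite \<Rightarrow> 'b::real_normed_vector)"
  shows "continuous_on UNIV (\<lambda>x. frechet_derivative f (at x) v)"
proof -
  let ?S = "- closure {x. f x \<noteq> 0}"
  have "Ck_on (Suc 0) f (- {0})"
    using f unfolding test_function_def smooth_on_def by blast
  then have "continuous_on (- {0}) (\<lambda>x. frechet_derivative f (at x) v)"
    by simp
  moreover have "continuous_on ?S (\<lambda>x. frechet_derivative f (at x) v)"
    by (subst continuous_on_cong[OF refl, where g = "\<lambda>_. 0"])
      (auto simp: test_function_frechet_derivative_outside[OF f])
  moreover have "UNIV = - {0} \<union> ?S"
    using f by (auto simp: test_function_def)
  ultimately show ?thesis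
    by (metis continuous_on_open_Un open_Compl closed_closure closed_singleton)
qed

section \<open>Lebesgue measure under linear maps\<close>

lemma nn_integral_lborel_translate:
  fixes f :: "'a::euclidean_space \<Rightarrow> ennreal"
  assumes [measurable]: "f \<in> borel_measurable borel"
  shows "(\<integral>\<^sup>+ x. f (a + x) \<partial>lborel) = (\<integral>\<^sup>+ x. f x \<partial>lborel)"
proof -
  have "(\<integral>\<^sup>+ x. f x \<partial>lborel) = (\<integral>\<^sup>+ x. f x \<partial>distr lborel borel ((+) a))"
    by (simp add: lborel_distr_plus)
  also have "\<dots> = (\<integral>\<^sup>+ x. f (a + x) \<partial>lborel)"
    by (subst nn_integral_distr) auto
  finally show ?thesis by simp
qed

text \<open>The image of Lebesgue measure under a linear bijection is translation invariant, hence a multiple of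
Lebesgue measure. The uniqueness is the usual double-integral argument: \<open>\<integral> f\<close> times
\<open>\<integral> g \<circ> L\<close> is rewritten by two translations as \<open>\<integral> f \<circ> L\<close> times \<open>\<integral> g\<close>, for the
indicator \<open>f\<close> of the unit ball, which is even. The constant is not identified: it cancels when a
diagonal map is conjugated by a linear one.\<close>

lemma nn_integral_lborel_linear:
  fixes L L' :: "'a::euclidean_space \<Rightarrow> 'a"
  assumes L: "linear L" and L': "linear L'" and inv: "\<And>x. L (L' x) = x" "\<And>x. L' (L x) = x"
  obtains c where "c > 0" "c < \<infinity>" "\<And>g. g \<in> borel_measurable borel \<Longrightarrow>
    (\<integral>\<^sup>+ x. g (L x) \<partial>lborel) = c * (\<integral>\<^sup>+ x. g x \<partial>lborel)"
proof -
  have contL: "continuous_on UNIV L" and contL': "continuous_on UNIV L'"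
    using L L' by (simp_all add: linear_continuous_on linear_conv_bounded_linear)
  have [measurable]: "L \<in> borel_measurable borel"
    using contL by (rule borel_measurable_continuous_onI)
  let ?B = "ball (0::'a) 1"
  have [measurable]: "?B \<in> sets borel" by simp
  let ?f = "indicator ?B :: 'a \<Rightarrow> ennreal"
  let ?I = "\<lambda>g::'a \<Rightarrow> ennreal. \<integral>\<^sup>+ x. g x \<partial>lborel"
  have key: "?I ?f * ?I (\<lambda>y. g (L y)) = ?I (\<lambda>y. ?f (L y)) * ?I g"
    if [measurable]: "g \<in> borel_measurable borel" for g
  proof -
    have shift: "?I (\<lambda>y. k (x + L y)) = ?I (\<lambda>y. k (L y))"
      if [measurable]: "k \<in> borel_measurable borel" for k x
      using nn_integral_lborel_translate[of "\<lambda>y. k (L y)" "L' x"]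
      by (simp add: linear_add[OF L] inv)
    have "?I ?f * ?I (\<lambda>y. g (L y)) = (\<integral>\<^sup>+ x. ?f x * (\<integral>\<^sup>+ y. g (L y) \<partial>lborel) \<partial>lborel)"
      by (rule nn_integral_multc[symmetric]) measurable
    also have "\<dots> = (\<integral>\<^sup>+ x. (\<integral>\<^sup>+ y. ?f x * g (x + L y) \<partial>lborel) \<partial>lborel)"
      by (intro nn_integral_cong) (simp add: nn_integral_cmult shift)
    also have "\<dots> = (\<integral>\<^sup>+ y. (\<integral>\<^sup>+ x. ?f x * g (x + L y) \<partial>lborel) \<partial>lborel)"
      by (rule lborel_pair.Fubini') simp
    also have "\<dots> = (\<integral>\<^sup>+ y. (\<integral>\<^sup>+ x. ?f (x - L y) * g x \<partial>lborel) \<partial>lborel)"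
    proof (rule nn_integral_cong)
      fix y
      show "(\<integral>\<^sup>+ x. ?f x * g (x + L y) \<partial>lborel) = (\<integral>\<^sup>+ x. ?f (x - L y) * g x \<partial>lborel)"
        using nn_integral_lborel_translate[of "\<lambda>x. ?f (x - L y) * g x" "L y"]
        by (simp add: add.commute)
    qed
    also have "\<dots> = (\<integral>\<^sup>+ x. (\<integral>\<^sup>+ y. ?f (x - L y) * g x \<partial>lborel) \<partial>lborel)"
      by (rule lborel_pair.Fubini') simp
    also have "\<dots> = (\<integral>\<^sup>+ x. ?I (\<lambda>y. ?f (L y)) * g x \<partial>lborel)"
    proof (rule nn_integral_cong)
      fix x
      have "(\<lambda>y. ?f (x - L y)) = (\<lambda>y. ?f (- x + L y))"
        by (auto simp: indicator_def fun_eq_iff norm_minus_commute)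
      then have "?I (\<lambda>y. ?f (x - L y)) = ?I (\<lambda>y. ?f (L y))"
        using shift[of ?f "- x"] by simp
      then show "(\<integral>\<^sup>+ y. ?f (x - L y) * g x \<partial>lborel) = ?I (\<lambda>y. ?f (L y)) * g x"
        by (subst nn_integral_multc) auto
    qed
    also have "\<dots> = ?I (\<lambda>y. ?f (L y)) * ?I g"
      by (rule nn_integral_cmult) simp
    finally show ?thesis .
  qed
  have f: "?I ?f = emeasure lborel ?B" by simp
  have fL: "?I (\<lambda>y. ?f (L y)) = emeasure lborel (L -` ?B)"
    by (subst nn_integral_indicator[symmetric])
      (auto simp: indicator_def intro!: nn_integral_cong measurable_sets_borel[of L borel])
  have "L -` ?B = L' ` ?B" 
  proof (intro Set.set_eqI iffI)
    fix x assume "x \<in> L -` ?B"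
    then show "x \<in> L' ` ?B" using inv(2)[of x, symmetric] by (intro image_eqI) auto
  qed (auto simp: inv)
  moreover have "bounded (L' ` ?B)"
    using bounded_linear_image[of ?B L'] L' by (simp add: linear_conv_bounded_linear)
  ultimately have fin: "emeasure lborel (L -` ?B) < \<infinity>"
    by (simp only:) (metis emeasure_bounded_finite infinity_ennreal_def)
  have "open (L -` ?B)" using contL by (simp add: open_vimage)
  moreover have "0 \<in> L -` ?B" using linear_0[OF L] by simp
  ultimately have "\<not> negligible (L -` ?B)" and [measurable]: "L -` ?B \<in> sets borel"
    using open_not_negligible[of "L -` ?B"] borel_open[of "L -` ?B"] by blast+
  then have "emeasure lborel (L -` ?B) \<noteq> 0"
    by (metis negligible_iff_null_sets null_setsI null_sets_completionI sets_lborel)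
  then have pos: "emeasure lborel (L -` ?B) > 0"
    by (simp add: zero_less_iff_neq_zero)
  have B: "emeasure lborel ?B \<noteq> 0" "emeasure lborel ?B \<noteq> \<infinity>"
  proof -
    have "\<not> negligible ?B" using open_not_negligible[of ?B] by auto
    then show "emeasure lborel ?B \<noteq> 0"
      by (metis borel_open negligible_iff_null_sets null_setsI null_sets_completionI open_ball sets_lborel)
    show "emeasure lborel ?B \<noteq> \<infinity>"
      using emeasure_bounded_finite[of ?B] by simp
  qed
  show ?thesis
  proof
    let ?c = "emeasure lborel (L -` ?B) / emeasure lborel ?B"
    show "?c > 0" using pos B by (simp add: ennreal_zero_less_divide top.not_eq_extremum)
    show "?c < \<infinity>" using fin B by (simp add: ennreal_divide_eq_top_iff less_top[symmetric])
    fix g :: "'a \<Rightarrow> ennreal" assume g: "g \<in> borel_measurable borel"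
    have "?I (\<lambda>y. g (L y)) = (emeasure lborel ?B * ?I (\<lambda>y. g (L y))) / emeasure lborel ?B"
      using B by (subst mult.commute) (simp add: ennreal_mult_divide_eq)
    also have "\<dots> = ?c * ?I g"
      using key[OF g] unfolding f fL by (simp add: ennreal_times_divide mult.commute)
    finally show "?I (\<lambda>y. g (L y)) = ?c * ?I g" .
  qed
qed

lemma matrix_vector_mult_columns:
  fixes P :: "real ^ 'n::finite ^ 'n" 
  shows "P *v y = (\<Sum>j\<in>UNIV. y $ j *\<^sub>R column j P)"
  by (simp add: matrix_mult_sum scalar_mult_eq_scaleR)

text \<open>The columns of \<open>P\<close> are the eigenvectors, so \<open>P\<close> conjugates \<open>A\<close> to the diagonal matrix with entries
\<open>\<nu>\<close>, whose trace is that of \<open>A\<close>.\<close>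

lemma eigen_coordinates:
  fixes A :: "real ^ 'n::finite \<Rightarrow> real ^ 'n"
  assumes A: "linear A" and diag: "diagonalisable_positive A"
  obtains P P' :: "real ^ 'n ^ 'n" and \<nu> :: "real ^ 'n"
  where "P ** P' = mat 1" "P' ** P = mat 1" 
    "\<And>y. A (P *v y) = P *v (\<chi> i. \<nu> $ i * y $ i)" "(\<Sum>i\<in>UNIV. \<nu> $ i) = homogeneous_dim A"
proof -
  obtain B where B: "independent B" "span B = UNIV" and ev: "\<forall>b\<in>B. \<exists>\<nu>>0. A b = \<nu> *\<^sub>R b"
    using diag by (auto simp: diagonalisable_positive_def)
  have "card B = CARD('n)"
    using B dim_eq_card[of B UNIV] by (simp add: dim_UNIV)
  moreover have "finite B" using B by (simp add: finiteI_independent)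
  ultimately obtain b where b: "bij_betw b (UNIV :: 'n set) B"
    using finite_same_card_bij[of "UNIV :: 'n set" B] by auto
  obtain \<mu> where \<mu>: "\<And>x. x \<in> B \<Longrightarrow> A x = \<mu> x *\<^sub>R x" using ev by metis
  define P :: "real ^ 'n ^ 'n" where "P = (\<chi> i j. b j $ i)"
  define \<nu> :: "real ^ 'n" where "\<nu> = (\<chi> j. \<mu> (b j))"
  have col: "column j P = b j" for j
    by (simp add: P_def column_def vec_eq_iff)
  have "columns P = B"
    using b by (auto simp: columns_def col bij_betw_def)
  then obtain P' where P': "P ** P' = mat 1"
    using matrix_right_invertible_span_columns[of P] B by (auto simp: span_vec_eq)
  then have P'': "P' ** P = mat 1" by (simp add: matrix_left_right_inverse)
  have AP: "A (P *v y) = P *v (\<chi> i. \<nu> $ i * y $ i)" for y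
  proof -
    have "A (b j) = \<nu> $ j *\<^sub>R b j" for j
      using b \<mu>[of "b j"] by (auto simp: \<nu>_def bij_betw_def)
    then show ?thesis
      by (simp add: matrix_vector_mult_columns col linear_sum[OF A] linear_cmul[OF A] mult.commute)
  qed
  define D :: "real ^ 'n ^ 'n" where "D = (\<chi> i j. if i = j then \<nu> $ i else 0)"
  have D: "D *v y = (\<chi> i. \<nu> $ i * y $ i)" for y
    by (simp add: D_def matrix_vector_mult_def vec_eq_iff if_distrib if_distribR cong: if_cong)
  have "A x = (P ** D ** P') *v x" for x
    using AP[of "P' *v x"] P' by (simp add: matrix_vector_mul_assoc D[symmetric] matrix_mul_assoc)
  then have "A = (*v) (P ** D ** P')" by (rule ext)
  then have "matrix A = P ** D ** P'"
    by (metis matrix_of_matrix_vector_mul)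
  then have "homogeneous_dim A = trace (P' ** (P ** D))"
    using trace_mul_sym[of "P ** D" P'] by (simp add: homogeneous_dim_def)
  also have "\<dots> = trace D" by (simp add: matrix_mul_assoc P'')
  also have "\<dots> = (\<Sum>i\<in>UNIV. \<nu> $ i)" by (simp add: trace_def D_def)
  finally show ?thesis using that[OF P' P'' AP] by simp
qed

lemma nn_integral_lborel_diag:
  fixes \<nu> :: "real ^ 'n::finite" and g :: "real ^ 'n \<Rightarrow> ennreal"
  assumes [measurable]: "g \<in> borel_measurable borel"
  shows "ennreal (exp (s * (\<Sum>i\<in>UNIV. \<nu> $ i))) * (\<integral>\<^sup>+ x. g (\<chi> i. exp (s * \<nu> $ i) * x $ i) \<partial>lborel) = (\<integral>\<^sup>+ x. g x \<partial>lborel)"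
proof -
  let ?T = "\<lambda>x. \<Sum>j\<in>Basis. (exp (s * (j \<bullet> \<nu>)) * (x \<bullet> j)) *\<^sub>R j"
  have B: "(Basis :: (real ^ 'n) set) = range (\<lambda>i. axis i 1)"
    by (auto simp: Basis_vec_def)
  have inj: "inj (\<lambda>i. axis i (1::real) :: real ^ 'n)"
    by (auto simp: inj_on_def axis_eq_axis)
  have T: "?T x = (\<chi> i. exp (s * \<nu> $ i) * x $ i)" for x
  proof -
    have "?T x = (\<Sum>i\<in>UNIV. (exp (s * \<nu> $ i) * x $ i) *\<^sub>R axis i 1)"
      unfolding B by (subst sum.reindex[OF inj]) (simp add: inner_axis inner_axis')
    then show ?thesis
      by (simp add: vec_eq_iff axis_def if_distrib cong: if_cong)
  qed
  have Tm: "?T \<in> borel_measurable borel" by measurable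
  have prod: "(\<Prod>j\<in>(Basis :: (real ^ 'n) set). \<bar>exp (s * (j \<bullet> \<nu>))\<bar>) = exp (s * (\<Sum>i\<in>UNIV. \<nu> $ i))"
    unfolding B by (subst prod.reindex[OF inj]) (simp add: inner_axis' exp_sum sum_distrib_left)
  have "(\<integral>\<^sup>+ x. g x \<partial>lborel) = (\<integral>\<^sup>+ x. g x \<partial>density (distr lborel borel ?T)
      (\<lambda>_. ennreal (exp (s * (\<Sum>i\<in>UNIV. \<nu> $ i)))))"
    using lborel_affine_euclidean[of "\<lambda>j. exp (s * (j \<bullet> \<nu>))" 0] prod by simp
  also have "\<dots> = ennreal (exp (s * (\<Sum>i\<in>UNIV. \<nu> $ i))) * (\<integral>\<^sup>+ x. g (?T x) \<partial>lborel)"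
    using Tm by (simp add: nn_integral_density nn_integral_distr nn_integral_cmult)
  finally show ?thesis by (simp only: T)
qed

section \<open>The dilation flow\<close>

locale dilation_flow =
  fixes A :: "real ^ 'n::finite \<Rightarrow> real ^ 'n"
  assumes linear_A: "linear A" and diagonalisable: "diagonalisable_positive A"
begin

abbreviation Q :: real where "Q \<equiv> homogeneous_dim A"

text \<open>In the logarithmic parameter \<open>s = ln \<lambda>\<close> the dilations form a one-parameter group.\<close>

definition flow :: "real \<Rightarrow> real ^ 'n \<Rightarrow> real ^ 'n" where
  "flow s x = dilation A (exp s) x"

text \<open>The exponential series converges in each eigencoordinate separately.\<close>

lemma flow_diagonal:
  assumes AP: "\<And>y. A (P *v y) = P *v (\<chi> i. \<nu> $ i * y $ i)"
  shows "flow s (P *v y) = P *v (\<chi> i. exp (s * \<nu> $ i) * y $ i)"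
proof -
  have pow: "(A ^^ k) (P *v y) = P *v (\<chi> i. (\<nu> $ i) ^ k * y $ i)" for k
    by (induction k) (simp_all add: AP mult.assoc)
  have "(\<lambda>k. (s ^ k / fact k) *\<^sub>R (A ^^ k) (P *v y)) sums (P *v (\<chi> i. exp (s * \<nu> $ i) * y $ i))"
  proof -
    have "(\<lambda>k. (s * \<nu> $ i) ^ k /\<^sub>R fact k * y $ i) sums (exp (s * \<nu> $ i) * y $ i)" for i
      by (intro sums_mult2 exp_converges)
    then have "(\<lambda>k. \<chi> i. (s * \<nu> $ i) ^ k /\<^sub>R fact k * y $ i) sums (\<chi> i. exp (s * \<nu> $ i) * y $ i)"
      unfolding sums_def by (intro vec_tendstoI) simp
    then have "(\<lambda>k. P *v (\<chi> i. (s * \<nu> $ i) ^ k /\<^sub>R fact k * y $ i)) sums (P *v (\<chi> i. exp (s * \<nu> $ i) * y $ i))"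
      by (rule bounded_linear.sums[OF matrix_vector_mul_bounded_linear])
    moreover have "P *v (\<chi> i. (s * \<nu> $ i) ^ k /\<^sub>R fact k * y $ i) = (s ^ k / fact k) *\<^sub>R (A ^^ k) (P *v y)" for k
      unfolding pow matrix_vector_mult_scaleR[symmetric]
      by (rule arg_cong[where f = "\<lambda>v. P *v v"]) (simp add: vec_eq_iff power_mult_distrib field_simps)
    ultimately show ?thesis by simp
  qed
  then show ?thesis
    by (simp add: flow_def dilation_def sums_unique[symmetric])
qed

lemma flow_coordinates:
  obtains P P' :: "real ^ 'n ^ 'n" and \<nu> :: "real ^ 'n"
  where "P ** P' = mat 1" "P' ** P = mat 1" "(\<Sum>i\<in>UNIV. \<nu> $ i) = Q"
    "\<And>x. A x = P *v (\<chi> i. \<nu> $ i * (P' *v x) $ i)"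
    "\<And>s x. flow s x = P *v (\<chi> i. exp (s * \<nu> $ i) * (P' *v x) $ i)"
proof -
  obtain P P' :: "real ^ 'n ^ 'n" and \<nu> :: "real ^ 'n" where P: "P ** P' = mat 1" "P' ** P = mat 1" 
    and AP: "\<And>y. A (P *v y) = P *v (\<chi> i. \<nu> $ i * y $ i)" and Q: "(\<Sum>i\<in>UNIV. \<nu> $ i) = Q"
    using eigen_coordinates[OF linear_A diagonalisable] by metis
  have PP: "P *v (P' *v x) = x" for x by (simp add: matrix_vector_mul_assoc P)
  show ?thesis
    using that[OF P Q] AP[of "P' *v _"] flow_diagonal[OF AP, of _ "P' *v _"] unfolding PP by blast
qed

lemma flow_0 [simp]: "flow 0 x = x"
proof -
  obtain P P' :: "real ^ 'n ^ 'n" and \<nu> :: "real ^ 'n" where P: "P ** P' = mat 1" "P' ** P = mat 1" "(\<Sum>i\<in>UNIV. \<nu> $ i) = Q"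
    and a: "\<And>x. A x = P *v (\<chi> i. \<nu> $ i * (P' *v x) $ i)"
    and f: "\<And>s x. flow s x = P *v (\<chi> i. exp (s * \<nu> $ i) * (P' *v x) $ i)"
    by (rule flow_coordinates) (rule that)
  show ?thesis unfolding f by (simp add: matrix_vector_mul_assoc P)
qed

lemma flow_add: "flow s (flow t x) = flow (s + t) x"
proof -
  obtain P P' :: "real ^ 'n ^ 'n" and \<nu> :: "real ^ 'n" where P: "P ** P' = mat 1" "P' ** P = mat 1" "(\<Sum>i\<in>UNIV. \<nu> $ i) = Q"
    and a: "\<And>x. A x = P *v (\<chi> i. \<nu> $ i * (P' *v x) $ i)"
    and f: "\<And>s x. flow s x = P *v (\<chi> i. exp (s * \<nu> $ i) * (P' *v x) $ i)"
    by (rule flow_coordinates) (rule that)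
  show ?thesis unfolding f
    by (simp add: matrix_vector_mul_assoc P distrib_right exp_add mult.assoc)
qed

lemma linear_flow: "linear (flow s)"
proof -
  obtain P P' :: "real ^ 'n ^ 'n" and \<nu> :: "real ^ 'n" where P: "P ** P' = mat 1" "P' ** P = mat 1" "(\<Sum>i\<in>UNIV. \<nu> $ i) = Q"
    and a: "\<And>x. A x = P *v (\<chi> i. \<nu> $ i * (P' *v x) $ i)"
    and f: "\<And>s x. flow s x = P *v (\<chi> i. exp (s * \<nu> $ i) * (P' *v x) $ i)"
    by (rule flow_coordinates) (rule that)
  show ?thesis
    unfolding f
  proof (rule linear_compose[OF _ matrix_vector_mul_linear, unfolded o_def])
    have "linear (\<lambda>x. \<chi> i. exp (s * \<nu> $ i) * x $ i)"
      by (rule linearI) (simp_all add: vec_eq_iff distrib_left)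
    from linear_compose[OF matrix_vector_mul_linear this, unfolded o_def]
    show "linear (\<lambda>x. \<chi> i. exp (s * \<nu> $ i) * (P' *v x) $ i)" .
  qed
qed

lemma flow_zero [simp]: "flow s 0 = 0"
  using linear_0[OF linear_flow] .

lemma flow_eq_0_iff [simp]: "flow s x = 0 \<longleftrightarrow> x = 0"
proof
  assume "flow s x = 0"
  then have "flow (- s) (flow s x) = 0" by simp
  then show "x = 0" by (simp add: flow_add)
qed simp

lemma continuous_flow: "continuous_on UNIV (\<lambda>(s, x). flow s x)"
proof -
  obtain P P' :: "real ^ 'n ^ 'n" and \<nu> :: "real ^ 'n" where P: "P ** P' = mat 1" "P' ** P = mat 1" "(\<Sum>i\<in>UNIV. \<nu> $ i) = Q"
    and a: "\<And>x. A x = P *v (\<chi> i. \<nu> $ i * (P' *v x) $ i)"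
    and f: "\<And>s x. flow s x = P *v (\<chi> i. exp (s * \<nu> $ i) * (P' *v x) $ i)"
    by (rule flow_coordinates) (rule that)
  show ?thesis
    unfolding f case_prod_unfold
    by (intro continuous_intros linear_continuous_on_compose[OF _ matrix_vector_mul_linear])
qed

lemma flow_has_vector_derivative:
  "((\<lambda>s. flow s x) has_vector_derivative A (flow s x)) (at s within S)"
proof -
  obtain P P' :: "real ^ 'n ^ 'n" and \<nu> :: "real ^ 'n" where P: "P ** P' = mat 1" "P' ** P = mat 1" "(\<Sum>i\<in>UNIV. \<nu> $ i) = Q"
    and a: "\<And>x. A x = P *v (\<chi> i. \<nu> $ i * (P' *v x) $ i)"
    and f: "\<And>s x. flow s x = P *v (\<chi> i. exp (s * \<nu> $ i) * (P' *v x) $ i)"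
    by (rule flow_coordinates) (rule that)
  have "((\<lambda>s. \<chi> i. exp (s * \<nu> $ i) * (P' *v x) $ i) has_vector_derivative
      (\<chi> i. \<nu> $ i * (exp (s * \<nu> $ i) * (P' *v x) $ i))) (at s within S)"
    unfolding has_vector_derivative_def
    by (subst has_derivative_componentwise_within)
      (auto simp: Basis_vec_def inner_axis intro!: derivative_eq_intros)
  then have "((\<lambda>s. P *v (\<chi> i. exp (s * \<nu> $ i) * (P' *v x) $ i)) has_vector_derivative
      P *v (\<chi> i. \<nu> $ i * (exp (s * \<nu> $ i) * (P' *v x) $ i))) (at s within S)"
    by (rule bounded_linear.has_vector_derivative[OF matrix_vector_mul_bounded_linear])
  then show ?thesis
    unfolding f a by (simp add: matrix_vector_mul_assoc P)
qed

lemma flow_A: "flow s (A x) = A (flow s x)"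
proof -
  obtain P P' :: "real ^ 'n ^ 'n" and \<nu> :: "real ^ 'n" where P: "P ** P' = mat 1" "P' ** P = mat 1" "(\<Sum>i\<in>UNIV. \<nu> $ i) = Q"
    and a: "\<And>x. A x = P *v (\<chi> i. \<nu> $ i * (P' *v x) $ i)"
    and f: "\<And>s x. flow s x = P *v (\<chi> i. exp (s * \<nu> $ i) * (P' *v x) $ i)"
    by (rule flow_coordinates) (rule that)
  show ?thesis unfolding f a by (simp add: matrix_vector_mul_assoc P mult.left_commute)
qed

lemma measurable_flow [measurable (raw)]:
  assumes [measurable]: "f \<in> borel_measurable M" "g \<in> borel_measurable M"
  shows "(\<lambda>x. flow (f x) (g x)) \<in> borel_measurable M"
  using borel_measurable_continuous_Pair[OF assms, of flow] continuous_flow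
  by (simp add: case_prod_unfold)

text \<open>The flow has determinant \<open>exp (s Q)\<close>: in eigencoordinates it is diagonal, and the scaling constants of
the two coordinate changes cancel.\<close>

lemma nn_integral_flow:
  fixes g :: "real ^ 'n \<Rightarrow> ennreal"
  assumes [measurable]: "g \<in> borel_measurable borel"
  shows "ennreal (exp (s * Q)) * (\<integral>\<^sup>+ x. g (flow s x) \<partial>lborel) = (\<integral>\<^sup>+ x. g x \<partial>lborel)"
proof -
  obtain P P' :: "real ^ 'n ^ 'n" and \<nu> :: "real ^ 'n" where P: "P ** P' = mat 1" "P' ** P = mat 1" "(\<Sum>i\<in>UNIV. \<nu> $ i) = Q"
    and a: "\<And>x. A x = P *v (\<chi> i. \<nu> $ i * (P' *v x) $ i)"
    and f: "\<And>s x. flow s x = P *v (\<chi> i. exp (s * \<nu> $ i) * (P' *v x) $ i)"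
    by (rule flow_coordinates) (rule that)
  obtain c where c: "\<And>g. g \<in> borel_measurable borel \<Longrightarrow>
    (\<integral>\<^sup>+ x. g (P' *v x) \<partial>lborel) = c * (\<integral>\<^sup>+ x. g x \<partial>lborel)"
    by (rule nn_integral_lborel_linear[of "\<lambda>x. P' *v x" "\<lambda>x. P *v x"])
      (auto simp: matrix_vector_mul_assoc P)
  have [measurable]: "(\<lambda>x. P *v x) \<in> borel_measurable borel" "(\<lambda>x. \<chi> i. exp (s * \<nu> $ i) * x $ i) \<in> borel_measurable borel"
    by (auto intro!: borel_measurable_continuous_onI continuous_intros
       linear_continuous_on_compose[OF _ matrix_vector_mul_linear])
  have "ennreal (exp (s * Q)) * (\<integral>\<^sup>+ x. g (flow s x) \<partial>lborel) =
     c * (ennreal (exp (s * Q)) * (\<integral>\<^sup>+ x. g (P *v (\<chi> i. exp (s * \<nu> $ i) * x $ i)) \<partial>lborel))"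
    unfolding f by (subst c[where g = "\<lambda>y. g (P *v (\<chi> i. exp (s * \<nu> $ i) * y $ i))"]) (simp_all add: mult.left_commute)
  also have "\<dots> = c * (\<integral>\<^sup>+ x. g (P *v x) \<partial>lborel)"
    unfolding P(3)[symmetric] by (subst nn_integral_lborel_diag[where g = "\<lambda>y. g (P *v y)"]) simp_all
  also have "\<dots> = (\<integral>\<^sup>+ x. g (P *v (P' *v x)) \<partial>lborel)"
    by (rule c[symmetric]) simp
  finally show ?thesis by (simp add: matrix_vector_mul_assoc P)
qed

lemma distr_flow: "density (distr lborel borel (flow s)) (\<lambda>_. ennreal (exp (s * Q))) = lborel"
proof (rule measure_eqI)
  fix X assume "X \<in> sets (density (distr lborel borel (flow s)) (\<lambda>_. ennreal (exp (s * Q))))"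
  then have [measurable]: "X \<in> sets borel" by simp
  have "emeasure (density (distr lborel borel (flow s)) (\<lambda>_. ennreal (exp (s * Q)))) X
     = ennreal (exp (s * Q)) * (\<integral>\<^sup>+ x. indicator X (flow s x) \<partial>lborel)"
    by (subst nn_integral_indicator[symmetric])
      (auto simp: nn_integral_density nn_integral_cmult nn_integral_distr simp del: nn_integral_indicator)
  also have "\<dots> = emeasure lborel X"
    by (subst nn_integral_flow) auto
  finally show "emeasure (density (distr lborel borel (flow s)) (\<lambda>_. ennreal (exp (s * Q)))) X = emeasure lborel X" .
qed simp

lemma
  fixes g :: "real ^ 'n \<Rightarrow> real"
  assumes [measurable]: "g \<in> borel_measurable borel"
  shows integrable_flow_iff: "integrable lborel (\<lambda>x. g (flow s x)) \<longleftrightarrow> integrable lborel g"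
    and integral_flow: "exp (s * Q) * (LINT x|lborel. g (flow s x)) = (LINT x|lborel. g x)"
proof -
  show "integrable lborel (\<lambda>x. g (flow s x)) \<longleftrightarrow> integrable lborel g"
    by (subst (2) distr_flow[of s, symmetric]) (simp add: integrable_density integrable_distr_eq)
  show "exp (s * Q) * (LINT x|lborel. g (flow s x)) = (LINT x|lborel. g x)"
    by (subst (2) distr_flow[of s, symmetric]) (simp add: integral_density integral_distr)
qed

end

section \<open>Testing against polynomials\<close>

lemma integrable_mult_bounded:
  fixes k g :: "'a \<Rightarrow> real"
  assumes k: "integrable M k" and [measurable]: "g \<in> borel_measurable M"
    and B: "\<And>z. k z \<noteq> 0 \<Longrightarrow> \<bar>g z\<bar> \<le> B"
  shows "integrable M (\<lambda>z. k z * g z)"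
proof (rule Bochner_Integration.integrable_bound[OF integrable_mult_right[OF k, of B]])
  show "AE z in M. norm (k z * g z) \<le> norm (B * k z)"
  proof (rule AE_I2)
    fix z
    show "norm (k z * g z) \<le> norm (B * k z)"
    proof (cases "k z = 0")
      case False
      have "\<bar>k z\<bar> * \<bar>g z\<bar> \<le> \<bar>k z\<bar> * \<bar>B\<bar>"
        using B[OF False] by (intro mult_left_mono) auto
      then show ?thesis by (simp add: abs_mult mult.commute)
    qed simp
  qed
qed (use k in measurable)

lemma integrable_mult_continuous:
  fixes k q :: "'a::euclidean_space \<Rightarrow> real"
  assumes k: "integrable lborel k" and C: "compact C" "\<And>x. x \<notin> C \<Longrightarrow> k x = 0"
    and q: "continuous_on UNIV q"
  shows "integrable lborel (\<lambda>x. k x * q x)"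
proof -
  obtain B where B: "\<And>x. x \<in> C \<Longrightarrow> norm (q x) \<le> B"
    using compact_imp_bounded[OF compact_continuous_image[OF continuous_on_subset[OF q] C(1)]]
    by (auto simp: bounded_iff)
  show ?thesis
    using C(2) B borel_measurable_continuous_onI[OF q] by (intro integrable_mult_bounded[OF k, of _ B]) auto
qed

text \<open>By the Stone-Weierstrass theorem \<open>h\<close> annihilates all continuous functions, by dominated convergence
the indicators of closed sets, and by the \<open>\<pi>\<close>-\<open>\<lambda>\<close> theorem those of all Borel sets.\<close>

lemma AE_eq_0_if_orthogonal_to_polynomials:
  fixes h :: "'a::euclidean_space \<Rightarrow> real"
  assumes h: "integrable lborel h" and C: "compact C" and supp: "\<And>x. x \<notin> C \<Longrightarrow> h x = 0"
    and orth: "\<And>p. real_polynomial_function p \<Longrightarrow> (LINT x|lborel. h x * p x) = 0"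
  shows "AE x in lborel. h x = 0"
proof -
  note [measurable] = borel_measurable_integrable[OF h, simplified]
  have cont: "(LINT x|lborel. h x * q x) = 0" if q: "continuous_on UNIV q" for q
  proof -
    have [measurable]: "q \<in> borel_measurable borel"
      using q by (rule borel_measurable_continuous_onI)
    have qi: "integrable lborel (\<lambda>x. h x * q x)"
      using h C supp q by (rule integrable_mult_continuous)
    have "\<bar>LINT x|lborel. h x * q x\<bar> \<le> e * (LINT x|lborel. \<bar>h x\<bar>)" if e: "e > 0" for e
    proof -
      obtain p where p: "real_polynomial_function p" "\<And>x. x \<in> C \<Longrightarrow> \<bar>q x - p x\<bar> < e"
        using Stone_Weierstrass_real_polynomial_function[OF C continuous_on_subset[OF q] e] by auto
      have "continuous_on UNIV p"
        using p(1) by (simp add: continuous_on_polymonial_function real_polynomial_function_eq)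
      then have [measurable]: "p \<in> borel_measurable borel"
        by (rule borel_measurable_continuous_onI)
      have bd: "\<bar>h x * (q x - p x)\<bar> \<le> e * \<bar>h x\<bar>" for x
      proof (cases "x \<in> C")
        case True
        have "\<bar>h x\<bar> * \<bar>q x - p x\<bar> \<le> \<bar>h x\<bar> * e"
          using p(2)[OF True] by (intro mult_left_mono) auto
        then show ?thesis by (simp add: abs_mult mult.commute)
      qed (simp add: supp)
      have di: "integrable lborel (\<lambda>x. h x * (q x - p x))"
        by (rule Bochner_Integration.integrable_bound[OF integrable_mult_right[OF integrable_abs[OF h], of e]])
          (use bd e in \<open>auto simp: abs_mult\<close>)
      have "integrable lborel (\<lambda>x. h x * p x)"
        using Bochner_Integration.integrable_diff[OF qi di] by (simp add: algebra_simps)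
      then have "(LINT x|lborel. h x * q x) = (LINT x|lborel. h x * (q x - p x))"
        using qi orth[OF p(1)] by (simp add: right_diff_distrib)
      also have "\<bar>\<dots>\<bar> \<le> (LINT x|lborel. \<bar>h x * (q x - p x)\<bar>)"
        by (rule integral_abs_bound)
      also have "\<dots> \<le> (LINT x|lborel. e * \<bar>h x\<bar>)"
        using di h bd by (intro integral_mono) auto
      finally show ?thesis by simp
    qed
    note small = this
    show ?thesis
    proof (rule ccontr)
      assume ne: "(LINT x|lborel. h x * q x) \<noteq> 0"
      let ?a = "\<bar>LINT x|lborel. h x * q x\<bar>" and ?b = "LINT x|lborel. \<bar>h x\<bar>"
      have b: "?b \<ge> 0" by simp
      have a: "?a > 0" using ne by simp
      have b1: "?b + 1 > 0" using b by (rule add_nonneg_pos) simp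
      have "r / (2 * (r + 1)) < 1" if "r \<ge> 0" for r :: real
        using that by (simp add: divide_less_eq)
      from this[OF b] have "?b / (2 * (?b + 1)) < 1" .
      then have "?a * (?b / (2 * (?b + 1))) < ?a * 1"
        using a by (rule mult_strict_left_mono)
      moreover have "?a \<le> ?a / (2 * (?b + 1)) * ?b"
        using a b1 by (intro small divide_pos_pos mult_pos_pos) simp_all
      ultimately show False by simp
    qed
  qed
  \<comment> \<open>The indicator of \<open>F\<close> is the limit of \<open>max 0 (1 - n d(x, F))\<close>.\<close>
  have closed: "(LINT x|lborel. indicator F x * h x) = 0" if F: "closed F" for F
  proof (cases "F = {}")
    case False
    let ?q = "\<lambda>n x. max 0 (1 - real n * infdist x F)"
    have qc: "continuous_on UNIV (?q n)" for n
      by (intro continuous_intros)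
    then have [measurable]: "?q n \<in> borel_measurable borel" for n
      by (rule borel_measurable_continuous_onI)
    have [measurable]: "F \<in> sets borel" using F by simp
    have "(\<lambda>n. LINT x|lborel. h x * ?q n x) \<longlonglongrightarrow> (LINT x|lborel. indicator F x * h x)"
    proof (rule integral_dominated_convergence[where w = "\<lambda>x. \<bar>h x\<bar>"])
      show "AE x in lborel. (\<lambda>n. h x * ?q n x) \<longlonglongrightarrow> indicator F x * h x"
      proof (rule AE_I2)
        fix x
        have "(\<lambda>n. ?q n x) \<longlonglongrightarrow> indicator F x"
        proof (cases "x \<in> F")
          case False
          then have d: "infdist x F > 0"
            using in_closed_iff_infdist_zero[OF F \<open>F \<noteq> {}\<close>, of x] infdist_nonneg[of x F] by linarith
          obtain n0 :: nat where n0: "1 / infdist x F < real n0"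
            using reals_Archimedean2 by blast
          have "?q n x = 0" if "n \<ge> n0" for n
          proof -
            have "1 / infdist x F \<le> real n" using n0 that by linarith
            then show ?thesis using d by (simp add: field_simps)
          qed
          then have "\<forall>\<^sub>F n in sequentially. ?q n x = 0"
            by (auto simp: eventually_sequentially)
          then show ?thesis using False by (simp add: tendsto_eventually)
        qed simp
        then show "(\<lambda>n. h x * ?q n x) \<longlonglongrightarrow> indicator F x * h x"
          by (subst mult.commute) (intro tendsto_intros)
      qed
      show "AE x in lborel. norm (h x * ?q n x) \<le> \<bar>h x\<bar>" for n
        by (intro AE_I2) (auto simp: abs_mult infdist_nonneg intro!: mult_left_le)
    qed (use h in auto)
    then show ?thesis
      using cont[OF qc] by (simp add: LIMSEQ_const_iff)
  qed simp
  have hi: "integrable lborel (\<lambda>x. indicator S x * h x)" if "S \<in> sets borel" for S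
    using integrable_mult_indicator[OF _ h, of S] that by simp
  have ind: "(LINT x|lborel. indicator F x * h x) = 0" if F: "F \<in> sets borel" for F
  proof -
    have F': "F \<in> sigma_sets UNIV (Collect closed)"
      using F by (simp add: borel_eq_closed)
    have int: "Int_stable (Collect closed :: 'a set set)" and sub: "Collect closed \<subseteq> Pow (UNIV :: 'a set)"
      by (auto simp: Int_stable_def)
    from int sub F' show ?thesis
    proof (induction rule: sigma_sets_induct_disjoint)
      case (basic F)
      then show ?case by (simp add: closed)
    next
      case empty
      show ?case by simp
    next
      case (compl F)
      have [measurable]: "F \<in> sets borel" using compl(1) by (simp add: borel_eq_closed)
      have i: "integrable lborel (\<lambda>x. indicator F x * h x)"
        using integrable_real_mult_indicator[OF _ h, of F] by (simp add: mult.commute)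
      have "(LINT x|lborel. indicator (UNIV - F) x * h x) = (LINT x|lborel. h x - indicator F x * h x)"
        by (intro Bochner_Integration.integral_cong) (auto simp: indicator_def)
      also have "\<dots> = 0" using i h compl(2) closed[of UNIV] by simp
      finally show ?case .
    next
      case (union A)
      have [measurable]: "A i \<in> sets borel" for i
        using union(2) by (auto simp: borel_eq_closed)
      have "set_lebesgue_integral lborel (\<Union>i. A i) h = (\<Sum>i. set_lebesgue_integral lborel (A i) h)"
        by (rule lebesgue_integral_countable_add)
          (use union(1) in \<open>auto simp: disjoint_family_on_def set_integrable_def intro!: hi\<close>)
      then show ?case using union(3) by (simp add: set_lebesgue_integral_def)
    qed
  qed
  show ?thesis
    using density_unique_real[of lborel h "\<lambda>_. 0"] h ind by (simp add: set_lebesgue_integral_def)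
qed

section \<open>The product rule on the line\<close>

text \<open>The product rule for two primitives vanishing at \<open>-\<infinity>\<close>: the two terms are the integrals of
\<open>w s * v t\<close> over the half-planes \<open>t < s\<close> and \<open>t > s\<close>, which together fill the plane up to a null
set.\<close>

lemma integral_mult_primitives:
  fixes w v :: "real \<Rightarrow> real"
  assumes w: "integrable lborel w" and v: "integrable lborel v"
  shows "(LINT s|lborel. w s * (LINT t|lborel. indicator {..<s} t * v t) + (LINT t|lborel. indicator {..<s} t * w t) * v s)
     = (LINT s|lborel. w s) * (LINT s|lborel. v s)" (is ?eq)
    and "integrable lborel (\<lambda>s. w s * (LINT t|lborel. indicator {..<s} t * v t))" (is ?i1)
    and "integrable lborel (\<lambda>s. (LINT t|lborel. indicator {..<s} t * w t) * v s)" (is ?i2)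
proof -
  note [measurable] = borel_measurable_integrable[OF w, simplified] borel_measurable_integrable[OF v, simplified]
  have prod: "integrable (lborel \<Otimes>\<^sub>M lborel) (\<lambda>(s, t). w s * v t)"
    by (rule lborel_pair.Fubini_integrable) (use w v in \<open>auto simp: abs_mult\<close>)
  let ?F = "\<lambda>(s, t). w s * (indicator {..<s} t * v t)" and ?G = "\<lambda>(s, t). w s * (indicator {s<..} t * v t)"
  have iF: "integrable (lborel \<Otimes>\<^sub>M lborel) ?F" 
    by (rule Bochner_Integration.integrable_bound[OF prod])
      (auto simp: indicator_def case_prod_unfold abs_mult)
  have iG: "integrable (lborel \<Otimes>\<^sub>M lborel) ?G"
    by (rule Bochner_Integration.integrable_bound[OF prod])
      (auto simp: indicator_def case_prod_unfold abs_mult)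
  have F: "(LINT s|lborel. w s * (LINT t|lborel. indicator {..<s} t * v t)) = (LINT s|lborel. LINT t|lborel. ?F (s, t))"
    and G: "(LINT s|lborel. (LINT t|lborel. indicator {..<s} t * w t) * v s) = (LINT s|lborel. LINT t|lborel. ?G (s, t))"
  proof -
    show "(LINT s|lborel. w s * (LINT t|lborel. indicator {..<s} t * v t)) = (LINT s|lborel. LINT t|lborel. ?F (s, t))"
      by simp
    have "(LINT s|lborel. LINT t|lborel. ?G (s, t)) = (LINT t|lborel. LINT s|lborel. ?G (s, t))"
      using lborel_pair.Fubini_integral[OF iG] by simp
    also have "\<dots> = (LINT t|lborel. LINT s|lborel. indicator {..<t} s * w s * v t)"
      by (intro Bochner_Integration.integral_cong) (auto simp: indicator_def)
    finally show "(LINT s|lborel. (LINT t|lborel. indicator {..<s} t * w t) * v s) = (LINT s|lborel. LINT t|lborel. ?G (s, t))"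
      by simp
  qed
  show i1: ?i1
    using lborel_pair.integrable_fst'[OF iF] by simp
  have "integrable lborel (\<lambda>t. LINT s|lborel. ?G (s, t))"
    using lborel_pair.integrable_snd[of "\<lambda>s t. ?G (s, t)"] iG by simp
  moreover have "(LINT s|lborel. ?G (s, t)) = (LINT s|lborel. indicator {..<t} s * w s) * v t" for t
  proof -
    have "(LINT s|lborel. ?G (s, t)) = (LINT s|lborel. (indicator {..<t} s * w s) * v t)"
      by (intro Bochner_Integration.integral_cong) (auto simp: indicator_def)
    then show ?thesis by simp
  qed
  ultimately show i2: ?i2 by simp
  have "(LINT s|lborel. w s * (LINT t|lborel. indicator {..<s} t * v t) + (LINT t|lborel. indicator {..<s} t * w t) * v s)
     = (LINT s|lborel. LINT t|lborel. ?F (s, t)) + (LINT s|lborel. LINT t|lborel. ?G (s, t))"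
    using i1 i2 F G by (subst Bochner_Integration.integral_add) auto
  also have "\<dots> = integral\<^sup>L (lborel \<Otimes>\<^sub>M lborel) (\<lambda>z. ?F z + ?G z)"
    using iF iG lborel_pair.integral_fst'[OF iF] lborel_pair.integral_fst'[OF iG] 
    by (subst Bochner_Integration.integral_add) auto
  also have "\<dots> = (LINT s|lborel. LINT t|lborel. ?F (s, t) + ?G (s, t))"
    using lborel_pair.integral_fst'[OF Bochner_Integration.integrable_add[OF iF iG]] by simp
  also have "\<dots> = (LINT s|lborel. LINT t|lborel. w s * v t)"
  proof (rule Bochner_Integration.integral_cong[OF refl], rule integral_cong_AE)
    fix s
    show "AE t in lborel. ?F (s, t) + ?G (s, t) = w s * v t"
      using AE_lborel_singleton[of s] by eventually_elim (auto simp: indicator_def)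
  qed simp_all
  finally show ?eq by simp
qed

section \<open>Polar coordinates\<close>

lemma enn2real_injective: "\<lbrakk>enn2real a = enn2real b; a \<noteq> \<infinity>; b \<noteq> \<infinity>\<rbrakk> \<Longrightarrow> a = b"
  by (cases a; cases b) auto

locale quasi_norm_flow = dilation_flow A for A :: "real ^ 'n::finite \<Rightarrow> real ^ 'n" +
  fixes N :: "real ^ 'n \<Rightarrow> real"
  assumes continuous_N: "continuous_on UNIV N" and N_nonneg: "N x \<ge> 0"
    and N_dilation: "lam > 0 \<Longrightarrow> N (dilation A lam x) = lam * N x"
    and N_eq_0_iff [simp]: "N x = 0 \<longleftrightarrow> x = 0"
begin

lemma N_pos [simp]: "N x > 0 \<longleftrightarrow> x \<noteq> 0"
  using N_nonneg[of x] N_eq_0_iff[of x] by linarith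

lemma N_flow: "N (flow s x) = exp s * N x"
  by (simp add: flow_def N_dilation)

lemma measurable_N [measurable]: "N \<in> borel_measurable borel"
  using continuous_N by (rule borel_measurable_continuous_onI)

definition annulus :: "(real ^ 'n) set" where
  "annulus = {x. 1 \<le> N x \<and> N x \<le> exp 1}"

lemma annulus_measurable [measurable]: "annulus \<in> sets borel"
  unfolding annulus_def by measurable

text \<open>Polar coordinates without a sphere measure. Tonelli's theorem and the change of variables
\<open>y = \<Phi>\<^sub>s x\<close> produce for each \<open>y \<noteq> 0\<close> the factor \<open>\<integral> 1(\<Phi>\<^bsub>-s\<^esub> y \<in> annulus) ds\<close>, the time that
the orbit of \<open>y\<close> spends in the annulus. It is 1 because the condition reads
\<open>ln |y| - 1 \<le> s \<le> ln |y|\<close>.\<close>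

lemma nn_integral_polar:
  fixes J :: "real ^ 'n \<Rightarrow> ennreal"
  assumes [measurable]: "J \<in> borel_measurable borel"
  shows "(\<integral>\<^sup>+ x. J x \<partial>lborel) =
    (\<integral>\<^sup>+ x. indicator annulus x * (\<integral>\<^sup>+ s. ennreal (exp (s * Q)) * J (flow s x) \<partial>lborel) \<partial>lborel)"
proof -
  have len: "(\<integral>\<^sup>+ s. indicator annulus (flow (- s) y) \<partial>lborel) = 1" if "y \<noteq> 0" for y
  proof -
    have "flow (- s) y \<in> annulus \<longleftrightarrow> s \<in> {ln (N y) - 1 .. ln (N y)}" for s
    proof -
      have "exp (- s) * N y = exp (ln (N y) - s)"
        using that by (simp add: exp_diff exp_minus field_simps)
      then show ?thesis
        by (auto simp: annulus_def N_flow)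
    qed
    then have "(\<integral>\<^sup>+ s. indicator annulus (flow (- s) y) \<partial>lborel) = (\<integral>\<^sup>+ s. indicator {ln (N y) - 1 .. ln (N y)} s \<partial>lborel)"
      by (intro nn_integral_cong) (simp only: indicator_def)
    then show ?thesis by simp
  qed
  have "(\<integral>\<^sup>+ x. indicator annulus x * (\<integral>\<^sup>+ s. ennreal (exp (s * Q)) * J (flow s x) \<partial>lborel) \<partial>lborel)
    = (\<integral>\<^sup>+ x. \<integral>\<^sup>+ s. indicator annulus x * (ennreal (exp (s * Q)) * J (flow s x)) \<partial>lborel \<partial>lborel)"
    by (intro nn_integral_cong nn_integral_cmult[symmetric]) measurable
  also have "\<dots> = (\<integral>\<^sup>+ s. \<integral>\<^sup>+ x. indicator annulus x * (ennreal (exp (s * Q)) * J (flow s x)) \<partial>lborel \<partial>lborel)"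
    by (rule lborel_pair.Fubini'[symmetric]) measurable
  also have "\<dots> = (\<integral>\<^sup>+ s. \<integral>\<^sup>+ y. indicator annulus (flow (- s) y) * J y \<partial>lborel \<partial>lborel)"
  proof (rule nn_integral_cong)
    fix s
    have "(\<integral>\<^sup>+ y. indicator annulus (flow (- s) y) * J y \<partial>lborel)
      = ennreal (exp (s * Q)) * (\<integral>\<^sup>+ x. indicator annulus x * J (flow s x) \<partial>lborel)"
      using nn_integral_flow[of "\<lambda>y. indicator annulus (flow (- s) y) * J y" s] by (simp add: flow_add)
    also have "\<dots> = (\<integral>\<^sup>+ x. indicator annulus x * (ennreal (exp (s * Q)) * J (flow s x)) \<partial>lborel)"
      by (subst nn_integral_cmult[symmetric]) (simp_all add: mult.left_commute)
    finally show "(\<integral>\<^sup>+ x. indicator annulus x * (ennreal (exp (s * Q)) * J (flow s x)) \<partial>lborel) =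
      (\<integral>\<^sup>+ y. indicator annulus (flow (- s) y) * J y \<partial>lborel)"
      by (rule sym)
  qed
  also have "\<dots> = (\<integral>\<^sup>+ y. \<integral>\<^sup>+ s. indicator annulus (flow (- s) y) * J y \<partial>lborel \<partial>lborel)"
    by (rule lborel_pair.Fubini') measurable
  also have "\<dots> = (\<integral>\<^sup>+ y. J y \<partial>lborel)"
    using AE_lborel_singleton[of "0 :: real ^ 'n"]
    by (intro nn_integral_cong_AE) (auto simp: nn_integral_multc len)
  finally show ?thesis by simp
qed

lemma AE_integrable_orbit:
  fixes J :: "real ^ 'n \<Rightarrow> real"
  assumes J: "integrable lborel J"
  shows "AE x in lborel. x \<in> annulus \<longrightarrow> integrable lborel (\<lambda>s. exp (s * Q) * J (flow s x))"
proof -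
  have [measurable]: "J \<in> borel_measurable borel" using J by auto
  have "(\<integral>\<^sup>+ x. indicator annulus x * (\<integral>\<^sup>+ s. ennreal (exp (s * Q)) * ennreal \<bar>J (flow s x)\<bar> \<partial>lborel) \<partial>lborel) < \<infinity>"
    using J by (subst nn_integral_polar[symmetric]) (auto simp: integrable_iff_bounded)
  then have "AE x in lborel. indicator annulus x * (\<integral>\<^sup>+ s. ennreal (exp (s * Q)) * ennreal \<bar>J (flow s x)\<bar> \<partial>lborel) \<noteq> \<infinity>"
    by (intro nn_integral_noteq_infinite) auto
  then show ?thesis
  proof eventually_elim
    case (elim x)
    show ?case
    proof
      assume "x \<in> annulus"
      then have "(\<integral>\<^sup>+ s. ennreal (exp (s * Q)) * ennreal \<bar>J (flow s x)\<bar> \<partial>lborel) < \<infinity>"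
        using elim by (simp add: less_top)
      then show "integrable lborel (\<lambda>s. exp (s * Q) * J (flow s x))"
        by (simp add: integrable_iff_bounded abs_mult ennreal_mult)
    qed
  qed
qed

text \<open>The positive and the negative part of \<open>J\<close> have the same integral over almost every orbit, so the
formula for nonnegative functions applies to each part.\<close>

lemma integral_eq_0_if_orbit_integrals_eq_0:
  fixes J :: "real ^ 'n \<Rightarrow> real"
  assumes J: "integrable lborel J"
    and zero: "AE x in lborel. x \<in> annulus \<longrightarrow> (LINT s|lborel. exp (s * Q) * J (flow s x)) = 0"
  shows "(LINT x|lborel. J x) = 0"
proof -
  have [measurable]: "J \<in> borel_measurable borel" using J by auto
  have "(\<integral>\<^sup>+ x. ennreal (J x) \<partial>lborel) = (\<integral>\<^sup>+ x. ennreal (- J x) \<partial>lborel)"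
    unfolding nn_integral_polar[of "\<lambda>x. ennreal (J x)", simplified] nn_integral_polar[of "\<lambda>x. ennreal (- J x)", simplified]
  proof (rule nn_integral_cong_AE)
    show "AE x in lborel. indicator annulus x * (\<integral>\<^sup>+ s. ennreal (exp (s * Q)) * ennreal (J (flow s x)) \<partial>lborel)
      = indicator annulus x * (\<integral>\<^sup>+ s. ennreal (exp (s * Q)) * ennreal (- J (flow s x)) \<partial>lborel)"
      using zero AE_integrable_orbit[OF J]
    proof eventually_elim
      case (elim x)
      show ?case
      proof (cases "x \<in> annulus")
        case True
        let ?k = "\<lambda>s. exp (s * Q) * J (flow s x)"
        have k: "integrable lborel ?k" "(LINT s|lborel. ?k s) = 0" using elim True by auto
        then have "enn2real (\<integral>\<^sup>+ s. ennreal (?k s) \<partial>lborel) = enn2real (\<integral>\<^sup>+ s. ennreal (- ?k s) \<partial>lborel)"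
          using real_lebesgue_integral_def[OF k(1)] by simp
        moreover have "(\<integral>\<^sup>+ s. ennreal (?k s) \<partial>lborel) \<noteq> \<infinity>" "(\<integral>\<^sup>+ s. ennreal (- ?k s) \<partial>lborel) \<noteq> \<infinity>"
          using k(1) by (simp_all add: real_integrable_def)
        ultimately have "(\<integral>\<^sup>+ s. ennreal (?k s) \<partial>lborel) = (\<integral>\<^sup>+ s. ennreal (- ?k s) \<partial>lborel)"
          by (rule enn2real_injective)
        moreover have "ennreal (?k s) = ennreal (exp (s * Q)) * ennreal (J (flow s x))"
          and "ennreal (- ?k s) = ennreal (exp (s * Q)) * ennreal (- J (flow s x))" for s
          by (simp_all add: ennreal_mult'[symmetric])
        ultimately show ?thesis by simp
      qed simp
    qed
  qed
  then show ?thesis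
    using real_lebesgue_integral_def[OF J] by simp
qed

end

section \<open>Transport along the flow\<close>

context dilation_flow
begin

text \<open>For differentiable \<open>f\<close> this is the derivative of \<open>s \<mapsto> f (\<Phi>\<^sub>s x)\<close> at \<open>s = 0\<close>.\<close>

definition Euler :: "(real ^ 'n \<Rightarrow> 'b::real_normed_vector) \<Rightarrow> real ^ 'n \<Rightarrow> 'b" where
  "Euler f x = frechet_derivative f (at x) (A x)"

lemma has_vector_derivative_along_flow:
  assumes "f differentiable at (flow s x)"
  shows "((\<lambda>s. f (flow s x)) has_vector_derivative Euler f (flow s x)) (at s within S)"
proof -
  have "(f has_derivative frechet_derivative f (at (flow s x))) (at (flow s x))"
    using assms by (simp add: frechet_derivative_works)
  then have "(f has_derivative frechet_derivative f (at (flow s x))) (at (flow s x) within (\<lambda>s. flow s x) ` S)"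
    by (rule has_derivative_at_withinI)
  from vector_derivative_diff_chain_within[OF flow_has_vector_derivative this]
  show ?thesis by (simp add: o_def Euler_def)
qed

lemma continuous_on_Euler:
  assumes f: "\<And>x. f differentiable at x"
    and c: "\<And>v. continuous_on UNIV (\<lambda>x. frechet_derivative f (at x) v)"
  shows "continuous_on UNIV (Euler f)"
proof -
  have A: "continuous_on UNIV A"
    using linear_A by (simp add: linear_continuous_on linear_conv_bounded_linear)
  have "Euler f x = (\<Sum>b\<in>Basis. (A x \<bullet> b) *\<^sub>R frechet_derivative f (at x) b)" for x
  proof -
    have "linear (frechet_derivative f (at x))" using f by (rule linear_frechet_derivative)
    then have "(\<Sum>b\<in>Basis. (A x \<bullet> b) *\<^sub>R frechet_derivative f (at x) b) =
        frechet_derivative f (at x) (\<Sum>b\<in>Basis. (A x \<bullet> b) *\<^sub>R b)"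
      by (simp add: linear_sum linear_cmul)
    then show ?thesis unfolding euclidean_representation Euler_def ..
  qed
  then have "Euler f = (\<lambda>x. \<Sum>b\<in>Basis. (A x \<bullet> b) *\<^sub>R frechet_derivative f (at x) b)" by (rule ext)
  then show ?thesis using A c by (auto intro!: continuous_intros)
qed

lemma continuous_on_Euler_polynomial:
  assumes "real_polynomial_function p"
  shows "continuous_on UNIV (Euler p)"
proof (rule continuous_on_Euler)
  have "Ck_on (Suc 0) p UNIV"
    using Ck_on_real_polynomial_function[OF assms open_UNIV] .
  then show "p differentiable at x" "continuous_on UNIV (\<lambda>x. frechet_derivative p (at x) v)" for x v
    by (auto simp: differentiable_on_eq_differentiable_at)
qed

lemma Euler_flow:
  assumes "p differentiable at (flow s x)"
  shows "Euler (\<lambda>x. p (flow s x)) x = Euler p (flow s x)"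
proof -
  have "(flow s has_derivative flow s) (at x)"
    using linear_flow by (simp add: linear_imp_has_derivative)
  moreover have "(p has_derivative frechet_derivative p (at (flow s x))) (at (flow s x))"
    using assms by (simp add: frechet_derivative_works)
  ultimately have "((\<lambda>x. p (flow s x)) has_derivative (\<lambda>v. frechet_derivative p (at (flow s x)) (flow s v))) (at x)"
    using diff_chain_at[of "flow s" "flow s" x p] by (simp add: o_def)
  then have "frechet_derivative (\<lambda>x. p (flow s x)) (at x) = (\<lambda>v. frechet_derivative p (at (flow s x)) (flow s v))"
    by (metis frechet_derivative_at)
  then show ?thesis by (simp add: Euler_def flow_A)
qed

lemma polynomial_flow:
  assumes "real_polynomial_function p"
  shows "real_polynomial_function (\<lambda>x. p (flow s x))"
proof -
  have "polynomial_function (flow s)"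
    using linear_flow by (simp add: polynomial_function_bounded_linear linear_conv_bounded_linear)
  from real_polynomial_function_compose[OF this assms] show ?thesis by (simp add: o_def)
qed

text \<open>The hypothesis says that \<open>W\<close> is the weak derivative of \<open>U\<close> along the flow, tested against
polynomials; the formal adjoint of \<open>E\<close> is \<open>- E - Q\<close> because the divergence of the generator is
\<open>Q\<close>. Polynomials suffice since \<open>U\<close> and \<open>W\<close> have compact support, and composing them with the flow
gives polynomials again. Tested against \<open>p\<close>, the left-hand side becomes the increment between
\<open>S0\<close> and \<open>S\<close> of the integral of \<open>U\<close> against \<open>exp ((c - Q) t) (p \<circ> \<Phi>\<^bsub>-t\<^esub>)\<close>, and by the
hypothesis for \<open>p \<circ> \<Phi>\<^bsub>-t\<^esub>\<close> the right-hand side becomes the time integral of \<open>U\<close> against the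
\<open>t\<close>-derivative \<open>r\<close> of that function. The exponent \<open>c\<close> is free so that powers of \<open>|x|\<close> and the
polar density can be shared between two factors.\<close>

lemma transport_along_flow:
  fixes U W :: "real ^ 'n \<Rightarrow> real"
  assumes U: "integrable lborel U" and W: "integrable lborel W"
    and C: "compact C" and U0: "\<And>x. x \<notin> C \<Longrightarrow> U x = 0" and W0: "\<And>x. x \<notin> C \<Longrightarrow> W x = 0"
    and weak: "\<And>p. real_polynomial_function p \<Longrightarrow>
      (LINT x|lborel. W x * p x) = - (LINT x|lborel. U x * (Euler p x + Q * p x))"
    and S: "S0 \<le> S"
  shows "AE x in lborel. exp (c * S) * U (flow S x) - exp (c * S0) * U (flow S0 x)
    = (LINT t|lborel. indicator {S0..S} t * (exp (c * t) * (W (flow t x) + c * U (flow t x))))"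
proof -
  have [measurable]: "U \<in> borel_measurable borel" "W \<in> borel_measurable borel" using U W by auto
  define V where "V y = W y + c * U y" for y
  have V: "integrable lborel V" using U W by (simp add: V_def[abs_def])
  have [measurable]: "V \<in> borel_measurable borel" using V by auto
  have V0: "V y = 0" if "y \<notin> C" for y using that by (simp add: V_def U0 W0)
  define F where "F = (\<lambda>(t, x). indicator {S0..S} t * (exp (c * t) * V (flow t x)) :: real)"
  have [measurable]: "F \<in> borel_measurable (lborel \<Otimes>\<^sub>M lborel)"
    unfolding F_def by measurable
  have F: "integrable (lborel \<Otimes>\<^sub>M lborel) F"
  proof (rule lborel_pair.Fubini_integrable)
    have eq: "(LINT x|lborel. norm (F (t, x))) = indicator {S0..S} t *\<^sub>R (exp ((c - Q) * t) * (LINT y|lborel. \<bar>V y\<bar>))" for t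
    proof -
      have "(LINT x|lborel. norm (F (t, x))) = indicator {S0..S} t * (exp (c * t) * (LINT x|lborel. \<bar>V (flow t x)\<bar>))"
        by (simp add: F_def abs_mult)
      also have "(LINT x|lborel. \<bar>V (flow t x)\<bar>) = exp (- t * Q) * (LINT y|lborel. \<bar>V y\<bar>)"
        using integral_flow[of "\<lambda>y. \<bar>V y\<bar>" t] by (simp add: exp_minus field_simps)
      also have "exp (c * t) * (exp (- t * Q) * (LINT y|lborel. \<bar>V y\<bar>)) = exp ((c - Q) * t) * (LINT y|lborel. \<bar>V y\<bar>)"
        by (simp add: mult.assoc[symmetric] exp_add[symmetric] algebra_simps)
      finally show ?thesis by simp
    qed
    show "integrable lborel (\<lambda>t. LINT x|lborel. norm (F (t, x)))"
      unfolding eq by (intro borel_integrable_compact) (auto intro!: continuous_intros)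
    show "AE t in lborel. integrable lborel (\<lambda>x. F (t, x))"
      using V by (simp add: F_def integrable_flow_iff)
  qed simp
  \<comment> \<open>The points whose orbit meets \<open>C\<close> between the times \<open>S0\<close> and \<open>S\<close>\<close>
  define D where "D = (\<lambda>(s, y). flow s y) ` ({- S .. - S0} \<times> C)"
  have D: "compact D"
    unfolding D_def using C
    by (intro compact_continuous_image continuous_on_subset[OF continuous_flow] compact_Times) auto
  have outside: "flow t x \<notin> C" if "x \<notin> D" "t \<in> {S0..S}" for t x
  proof
    assume "flow t x \<in> C"
    moreover have "x = flow (- t) (flow t x)" by (simp add: flow_add)
    ultimately have "x \<in> D"
      unfolding D_def using that(2) by (intro image_eqI[where x = "(- t, flow t x)"]) auto
    then show False using that(1) by simp
  qed
  define h where "h x = exp (c * S) * U (flow S x) - exp (c * S0) * U (flow S0 x) - (LINT t|lborel. F (t, x))" for x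
  have iF: "integrable lborel (\<lambda>x. LINT t|lborel. F (t, x))"
    using lborel_pair.integrable_snd[of "\<lambda>t x. F (t, x)"] F by simp
  have hi: "integrable lborel h"
    unfolding h_def[abs_def] using U iF by (intro Bochner_Integration.integrable_diff integrable_mult_right) (auto simp: integrable_flow_iff)
  have h0: "h x = 0" if "x \<notin> D" for x
  proof -
    have "F (t, x) = 0" for t using outside[OF that] by (auto simp: F_def V0 indicator_def)
    then show ?thesis using outside[OF that] S by (simp add: h_def U0)
  qed
  have orth: "(LINT x|lborel. h x * p x) = 0" if p: "real_polynomial_function p" for p
  proof -
    have pc: "continuous_on UNIV p"
      using p by (simp add: continuous_on_polymonial_function real_polynomial_function_eq)
    then have [measurable]: "p \<in> borel_measurable borel"
      by (rule borel_measurable_continuous_onI)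
    have pd: "p differentiable at x" for x
      using p by (rule differentiable_at_real_polynomial_function)
    have change: "(LINT x|lborel. exp (c * t) * k (flow t x) * p x) = exp ((c - Q) * t) * (LINT y|lborel. k y * p (flow (- t) y))"
      if [measurable]: "k \<in> borel_measurable borel" for k t
    proof -
      have "exp (t * Q) * (LINT x|lborel. k (flow t x) * p x) = (LINT y|lborel. k y * p (flow (- t) y))"
        using integral_flow[of "\<lambda>y. k y * p (flow (- t) y)" t] by (simp add: flow_add)
      then have "exp ((c - Q) * t) * (LINT y|lborel. k y * p (flow (- t) y)) = exp ((c - Q) * t) * exp (t * Q) * (LINT x|lborel. k (flow t x) * p x)"
        by simp
      also have "exp ((c - Q) * t) * exp (t * Q) = exp (c * t)"
        by (simp add: exp_add[symmetric] algebra_simps)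
      finally show ?thesis by (simp add: mult.assoc)
    qed
    define r where "r t y = exp ((c - Q) * t) * ((c - Q) * p (flow (- t) y) - Euler p (flow (- t) y))" for t y
    have rc: "continuous_on UNIV (\<lambda>(t, y). r t y)"
    proof -
      have fc: "continuous_on UNIV (\<lambda>z::real \<times> (real ^ 'n). flow (- fst z) (snd z))"
      proof -
        have "continuous_on UNIV (\<lambda>z::real \<times> (real ^ 'n). (- fst z, snd z))"
          by (intro continuous_intros)
        from continuous_on_compose2[OF continuous_flow this] show ?thesis by simp
      qed
      show ?thesis
        unfolding r_def case_prod_unfold
        by (intro continuous_intros continuous_on_compose2[OF pc fc]
           continuous_on_compose2[OF continuous_on_Euler_polynomial[OF p] fc]) auto
    qed
    then have [measurable]: "(\<lambda>(t, y). r t y) \<in> borel_measurable (borel \<Otimes>\<^sub>M borel)"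
      unfolding borel_prod by (rule borel_measurable_continuous_onI)
    have G: "(LINT t|lborel. indicator {S0..S} t *\<^sub>R r t y) = exp ((c - Q) * S) * p (flow (- S) y) - exp ((c - Q) * S0) * p (flow (- S0) y)" for y
    proof (rule integral_FTC_Icc[OF S])
      fix t
      have "(uminus has_vector_derivative - 1) (at t within {S0..S})"
        unfolding has_real_derivative_iff_has_vector_derivative[symmetric] by (auto intro!: derivative_eq_intros)
      then have "((\<lambda>t. p (flow (- t) y)) has_vector_derivative - Euler p (flow (- t) y)) (at t within {S0..S})"
        using vector_diff_chain_within[of uminus "-1" t "{S0..S}" "\<lambda>s. p (flow s y)" "Euler p (flow (- t) y)"]
          has_vector_derivative_along_flow[OF pd, where s = "- t" and x = y]
        by (auto simp: o_def intro!: derivative_eq_intros)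
      then show "((\<lambda>t. exp ((c - Q) * t) * p (flow (- t) y)) has_vector_derivative r t y) (at t within {S0..S})"
        unfolding r_def has_real_derivative_iff_has_vector_derivative[symmetric]
        by (auto intro!: derivative_eq_intros simp: algebra_simps)
      show "continuous_on {S0..S} (\<lambda>t. r t y)"
      proof -
        have "continuous_on {S0..S} (\<lambda>t. (t, y))"
          by (intro continuous_on_Pair continuous_on_id continuous_on_const)
        from continuous_on_compose2[OF rc this] show ?thesis by simp
      qed
    qed
    have qc: "continuous_on UNIV (\<lambda>y. p (flow s y))" for s
      using polynomial_flow[OF p] by (simp add: continuous_on_polymonial_function real_polynomial_function_eq)
    have Uq: "integrable lborel (\<lambda>y. U y * p (flow s y))" and Wq: "integrable lborel (\<lambda>y. W y * p (flow s y))" for s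
      using integrable_mult_continuous[OF U C U0 qc] integrable_mult_continuous[OF W C W0 qc] by auto
    have inner: "(LINT x|lborel. F (t, x) * p x) = (LINT y|lborel. indicator {S0..S} t * (U y * r t y))" for t
    proof (cases "t \<in> {S0..S}")
      case True
      have Ec: "continuous_on UNIV (\<lambda>y. Euler p (flow (- t) y) + Q * p (flow (- t) y))"
        using linear_flow continuous_on_Euler_polynomial[OF p]
        by (intro continuous_intros qc continuous_on_compose2[OF continuous_on_Euler_polynomial[OF p]])
          (auto simp: linear_continuous_on linear_conv_bounded_linear)
      have UE: "integrable lborel (\<lambda>y. U y * (Euler p (flow (- t) y) + Q * p (flow (- t) y)))"
        using integrable_mult_continuous[OF U C U0 Ec] .
      have "(LINT x|lborel. F (t, x) * p x) = exp ((c - Q) * t) * (LINT y|lborel. V y * p (flow (- t) y))"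
        using True change[of V t] by (simp add: F_def)
      also have "(LINT y|lborel. V y * p (flow (- t) y))
          = (LINT y|lborel. W y * p (flow (- t) y)) + c * (LINT y|lborel. U y * p (flow (- t) y))"
        using Uq[of "- t"] Wq[of "- t"] by (simp add: V_def distrib_right mult.assoc)
      also have "(LINT y|lborel. W y * p (flow (- t) y)) = - (LINT y|lborel. U y * (Euler p (flow (- t) y) + Q * p (flow (- t) y)))"
        using weak[OF polynomial_flow[OF p, of "- t"]] by (simp add: Euler_flow[OF pd])
      also have "- (LINT y|lborel. U y * (Euler p (flow (- t) y) + Q * p (flow (- t) y))) + c * (LINT y|lborel. U y * p (flow (- t) y))
        = (LINT y|lborel. c * (U y * p (flow (- t) y)) - U y * (Euler p (flow (- t) y) + Q * p (flow (- t) y)))"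
        using Uq[of "- t"] UE by simp
      also have "exp ((c - Q) * t) * \<dots> = (LINT y|lborel. U y * r t y)"
        by (subst integral_mult_right_zero[symmetric]) (auto intro!: Bochner_Integration.integral_cong simp: r_def algebra_simps)
      finally show ?thesis using True by simp
    qed (simp add: F_def)
    have "integrable (lborel \<Otimes>\<^sub>M lborel) (\<lambda>z. F z * p (snd z))"
    proof -
      obtain B where B: "\<And>x. x \<in> D \<Longrightarrow> norm (p x) \<le> B"
        using compact_imp_bounded[OF compact_continuous_image[OF continuous_on_subset[OF pc] D]]
        by (auto simp: bounded_iff)
      have "snd z \<in> D" if "F z \<noteq> 0" for z
        using that outside[of "snd z" "fst z"] V0[of "flow (fst z) (snd z)"]
        by (auto simp: F_def case_prod_unfold indicator_def split: if_splits)
      then show ?thesis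
        using B by (intro integrable_mult_bounded[OF F, of _ B]) auto
    qed
    then have Fp: "integrable (lborel \<Otimes>\<^sub>M lborel) (\<lambda>(t, x). F (t, x) * p x)"
      by (simp add: case_prod_unfold)
    have Ur: "integrable (lborel \<Otimes>\<^sub>M lborel) (\<lambda>(t, y). indicator {S0..S} t * (U y * r t y))"
    proof -
      have i1: "integrable (lborel \<Otimes>\<^sub>M lborel) (\<lambda>(t, y). indicator {S0..S} t * U y :: real)"
      proof -
        have "integrable lborel (indicator {S0..S} :: real \<Rightarrow> real)"
          using S by (intro integrable_real_indicator) auto
        then show ?thesis
          by (intro lborel_pair.Fubini_integrable) (use U in \<open>auto simp: abs_mult\<close>)
      qed
      obtain B where B: "\<And>z. z \<in> {S0..S} \<times> C \<Longrightarrow> norm ((\<lambda>(t, y). r t y) z) \<le> B"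
        using compact_imp_bounded[OF compact_continuous_image[OF continuous_on_subset[OF rc, of "{S0..S} \<times> C"]]] C
        by (auto simp: bounded_iff compact_Times)
      have "integrable (lborel \<Otimes>\<^sub>M lborel) (\<lambda>z. (case z of (t, y) \<Rightarrow> indicator {S0..S} t * U y) * (case z of (t, y) \<Rightarrow> r t y))"
      proof (rule integrable_mult_bounded[OF i1, of _ B])
        fix z assume "(case z of (t, y) \<Rightarrow> indicator {S0..S} t * U y) \<noteq> (0::real)"
        then have "z \<in> {S0..S} \<times> C" using U0 by (cases z) (auto simp: indicator_def split: if_splits)
        from B[OF this] show "\<bar>case z of (t, y) \<Rightarrow> r t y\<bar> \<le> B" by simp
      qed simp
      then show ?thesis by (simp add: case_prod_unfold mult.assoc)
    qed
    have "(LINT x|lborel. (LINT t|lborel. F (t, x)) * p x) = (LINT x|lborel. (LINT t|lborel. F (t, x) * p x))"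
      by simp
    also have "\<dots> = (LINT t|lborel. LINT x|lborel. F (t, x) * p x)"
      by (rule lborel_pair.Fubini_integral[OF Fp])
    also have "\<dots> = (LINT t|lborel. LINT y|lborel. indicator {S0..S} t * (U y * r t y))"
      by (simp only: inner)
    also have "\<dots> = (LINT y|lborel. LINT t|lborel. indicator {S0..S} t * (U y * r t y))"
      by (rule lborel_pair.Fubini_integral[OF Ur, symmetric])
    also have "\<dots> = (LINT y|lborel. U y * (LINT t|lborel. indicator {S0..S} t *\<^sub>R r t y))"
      by (simp add: mult.left_commute)
    also have "\<dots> = exp ((c - Q) * S) * (LINT y|lborel. U y * p (flow (- S) y)) - exp ((c - Q) * S0) * (LINT y|lborel. U y * p (flow (- S0) y))"
    proof -
      have "U y * (exp ((c - Q) * S) * p (flow (- S) y) - exp ((c - Q) * S0) * p (flow (- S0) y))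
        = exp ((c - Q) * S) * (U y * p (flow (- S) y)) - exp ((c - Q) * S0) * (U y * p (flow (- S0) y))" for y
        by (simp add: right_diff_distrib mult.left_commute)
      then show ?thesis
        using Uq[of "- S"] Uq[of "- S0"] unfolding G by simp
    qed
    also have "\<dots> = (LINT x|lborel. exp (c * S) * U (flow S x) * p x) - (LINT x|lborel. exp (c * S0) * U (flow S0 x) * p x)"
      by (simp only: change \<open>U \<in> borel_measurable borel\<close>)
    finally have eq: "(LINT x|lborel. (LINT t|lborel. F (t, x)) * p x) = (LINT x|lborel. exp (c * S) * U (flow S x) * p x) - (LINT x|lborel. exp (c * S0) * U (flow S0 x) * p x)" .
    have UF: "integrable lborel (\<lambda>x. exp (c * s) * U (flow s x) * p x)" if s: "s \<in> {S0..S}" for s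
      using U outside[OF _ s] U0
      by (intro integrable_mult_continuous[OF _ D _ pc]) (auto simp: integrable_flow_iff)
    have "F (t, x) = 0" if "x \<notin> D" for t x using outside[OF that] by (auto simp: F_def V0 indicator_def)
    then have "integrable lborel (\<lambda>x. (LINT t|lborel. F (t, x)) * p x)"
      by (intro integrable_mult_continuous[OF iF D _ pc]) simp
    then show ?thesis
      using UF[of S] UF[of S0] S eq by (simp add: h_def left_diff_distrib)
  qed
  have "AE x in lborel. h x = 0"
    using hi D h0 orth by (rule AE_eq_0_if_orthogonal_to_polynomials)
  then show ?thesis by (simp add: h_def F_def V_def)
qed

end

context quasi_norm_flow
begin

text \<open>On \<open>C\<close> the quasi-norm lies between two positive constants, while \<open>|\<Phi>\<^sub>s x| = exp s |x|\<close>.\<close>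

lemma orbit_leaves_compact:
  assumes C: "compact C" "0 \<notin> C"
  obtains T where "\<And>x s. \<lbrakk>x \<in> annulus; T \<le> \<bar>s\<bar>\<rbrakk> \<Longrightarrow> flow s x \<notin> C"
proof (cases "C = {}")
  case False
  obtain a where a: "a \<in> C" "\<And>y. y \<in> C \<Longrightarrow> N a \<le> N y"
    using continuous_attains_inf[OF C(1) False continuous_on_subset[OF continuous_N]] by auto
  obtain b where b: "b \<in> C" "\<And>y. y \<in> C \<Longrightarrow> N y \<le> N b"
    using continuous_attains_sup[OF C(1) False continuous_on_subset[OF continuous_N]] by auto
  have pos: "N a > 0" "N b > 0" using a(1) b(1) C(2) by auto
  show ?thesis
  proof (rule that[of "\<bar>ln (N a)\<bar> + \<bar>ln (N b)\<bar> + 2"])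
    fix x s assume x: "x \<in> annulus" and s: "\<bar>ln (N a)\<bar> + \<bar>ln (N b)\<bar> + 2 \<le> \<bar>s\<bar>"
    show "flow s x \<notin> C"
    proof
      assume C: "flow s x \<in> C"
      have Nx1: "1 \<le> N x" "N x \<le> exp 1" using x by (auto simp: annulus_def)
      then have Nx: "N x > 0" "0 \<le> ln (N x)" by (linarith, simp)
      have "ln (N x) \<le> ln (exp 1)"
        using Nx1 Nx by (subst ln_le_cancel_iff) auto
      then have Nx2: "ln (N x) \<le> 1" by simp
      have l: "ln (N (flow s x)) = s + ln (N x)"
        using Nx by (simp add: N_flow ln_mult)
      have "N (flow s x) > 0" using Nx by (simp add: N_flow)
      then have "ln (N a) \<le> s + ln (N x)" "s + ln (N x) \<le> ln (N b)"
        using a(2)[OF C] b(2)[OF C] pos unfolding l[symmetric] by (simp_all add: ln_le_cancel_iff)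
      then show False using s Nx Nx2 by linarith
    qed
  qed
qed auto

text \<open>On an orbit through the annulus \<open>U\<close> vanishes at very negative times, so the transport identity with an
early enough starting time expresses \<open>U\<close> as the primitive of its derivative, for each time and almost
every \<open>x\<close>. Fubini's theorem exchanges the two quantifiers. At late times \<open>U\<close> vanishes as well, so the
total integral of the derivative is zero.\<close>

lemma orbit_primitive:
  fixes U W :: "real ^ 'n \<Rightarrow> real" and c :: real
  defines "w \<equiv> \<lambda>x t. exp (c * t) * (W (flow t x) + c * U (flow t x))"
  assumes U: "integrable lborel U" and W: "integrable lborel W"
    and C: "compact C" "0 \<notin> C" and U0: "\<And>x. x \<notin> C \<Longrightarrow> U x = 0" and W0: "\<And>x. x \<notin> C \<Longrightarrow> W x = 0"
    and weak: "\<And>p. real_polynomial_function p \<Longrightarrow>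
      (LINT x|lborel. W x * p x) = - (LINT x|lborel. U x * (Euler p x + Q * p x))"
  shows "AE x in lborel. x \<in> annulus \<longrightarrow> integrable lborel (w x) \<and> (LINT t|lborel. w x t) = 0 \<and>
    (AE s in lborel. exp (c * s) * U (flow s x) = (LINT t|lborel. indicator {..<s} t * w x t))"
proof -
  have [measurable]: "U \<in> borel_measurable borel" "W \<in> borel_measurable borel" using U W by auto
  obtain T where T: "\<And>x s. \<lbrakk>x \<in> annulus; T \<le> \<bar>s\<bar>\<rbrakk> \<Longrightarrow> flow s x \<notin> C"
    using orbit_leaves_compact[OF C] by blast
  have wm[measurable]: "(\<lambda>(x, t). w x t) \<in> borel_measurable (borel \<Otimes>\<^sub>M borel)"
    unfolding w_def by measurable
  have w0: "w x t = 0" if "x \<in> annulus" "T \<le> \<bar>t\<bar>" for x t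
    using T[OF that] by (simp add: w_def U0 W0)
  have 1: "AE x in lborel. x \<in> annulus \<longrightarrow> integrable lborel (w x)"
  proof -
    have "AE x in lborel. x \<in> annulus \<longrightarrow> integrable lborel (\<lambda>s. exp (s * Q) * (W (flow s x) + c * U (flow s x)))"
      by (rule AE_integrable_orbit) (use U W in simp)
    then show ?thesis
    proof eventually_elim
      case (elim x)
      show ?case
      proof
        assume x: "x \<in> annulus"
        let ?k = "\<lambda>s. exp (s * Q) * (W (flow s x) + c * U (flow s x))"
        have "integrable lborel (\<lambda>s. ?k s * exp ((c - Q) * s))"
        proof (rule integrable_mult_bounded)
          show "integrable lborel ?k" using elim x by simp
          fix s assume "?k s \<noteq> 0"
          then have "flow s x \<in> C" by (rule contrapos_np) (simp add: U0 W0)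
          then have "\<bar>s\<bar> < T" using T[OF x, of s] by linarith
          then have "\<bar>c - Q\<bar> * \<bar>s\<bar> \<le> \<bar>c - Q\<bar> * T" by (intro mult_left_mono) auto
          then have "(c - Q) * s \<le> \<bar>c - Q\<bar> * T"
            using abs_ge_self[of "(c - Q) * s"] by (simp add: abs_mult)
          then show "\<bar>exp ((c - Q) * s)\<bar> \<le> exp (\<bar>c - Q\<bar> * T)" by simp
        qed simp
        moreover have "?k s * exp ((c - Q) * s) = w x s" for s
        proof -
          have "exp (s * Q) * exp ((c - Q) * s) = exp (c * s)"
            by (simp add: exp_add[symmetric] algebra_simps)
          then show ?thesis by (simp add: w_def mult.commute mult.left_commute)
        qed
        ultimately show "integrable lborel (w x)" by simp
      qed
    qed
  qed
  have "AE x in lborel. x \<in> annulus \<longrightarrow> exp (c * s) * U (flow s x) = (LINT t|lborel. indicator {..<s} t * w x t)" for s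
  proof -
    define S0 where "S0 = - (\<bar>s\<bar> + \<bar>T\<bar>)"
    have S0: "S0 \<le> s" "T \<le> \<bar>S0\<bar>" "\<And>t. t < S0 \<Longrightarrow> T \<le> \<bar>t\<bar>" by (auto simp: S0_def)
    have "AE x in lborel. exp (c * s) * U (flow s x) - exp (c * S0) * U (flow S0 x)
        = (LINT t|lborel. indicator {S0..s} t * w x t)"
      unfolding w_def by (rule transport_along_flow[OF U W C(1) U0 W0 weak S0(1)])
    then show ?thesis
    proof eventually_elim
      case (elim x)
      show ?case
      proof
        assume x: "x \<in> annulus"
        have [measurable]: "w x \<in> borel_measurable borel"
          using measurable_compose_Pair1[OF _ wm, of x] by simp
        have "U (flow S0 x) = 0" using T[OF x S0(2)] by (rule U0)
        then have "exp (c * s) * U (flow s x) = (LINT t|lborel. indicator {S0..s} t * w x t)"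
          using elim by simp
        also have "\<dots> = (LINT t|lborel. indicator {..<s} t * w x t)"
        proof (rule integral_cong_AE)
          show "AE t in lborel. indicator {S0..s} t * w x t = indicator {..<s} t * w x t"
            using AE_lborel_singleton[of s]
          proof eventually_elim
            case (elim t)
            then show ?case using w0[OF x S0(3)[of t]] by (auto simp: indicator_def)
          qed
        qed simp_all
        finally show "exp (c * s) * U (flow s x) = (LINT t|lborel. indicator {..<s} t * w x t)" .
      qed
    qed
  qed
  then have "AE s in lborel. AE x in lborel. x \<in> annulus \<longrightarrow> exp (c * s) * U (flow s x) = (LINT t|lborel. indicator {..<s} t * w x t)"
    by simp
  then have "AE x in lborel. AE s in lborel. x \<in> annulus \<longrightarrow> exp (c * s) * U (flow s x) = (LINT t|lborel. indicator {..<s} t * w x t)"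
  proof (subst (asm) lborel_pair.AE_commute)
    have [measurable]: "(\<lambda>z::real \<times> (real ^ 'n). LINT t|lborel. indicator {..<fst z} t * w (snd z) t) \<in> borel_measurable (borel \<Otimes>\<^sub>M borel)"
    proof -
      have "(\<lambda>(z, t). (if t < fst z then w (snd z) t else 0)) \<in> borel_measurable (((borel :: real measure) \<Otimes>\<^sub>M (borel :: (real ^ 'n) measure)) \<Otimes>\<^sub>M lborel)"
        by measurable
      also have "(\<lambda>(z, t). (if t < fst z then w (snd z) t else 0)) = (\<lambda>(z, t). indicator {..<fst z} t * w (snd z) t)"
        by (auto simp: fun_eq_iff)
      finally show ?thesis by (intro lborel.borel_measurable_lebesgue_integral) simp
    qed
    show "{z \<in> space (lborel \<Otimes>\<^sub>M lborel). snd z \<in> annulus \<longrightarrow> exp (c * fst z) * U (flow (fst z) (snd z))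
        = (LINT t|lborel. indicator {..<fst z} t * w (snd z) t)} \<in> sets (lborel \<Otimes>\<^sub>M lborel)"
      by measurable
  qed
  then have 2: "AE x in lborel. x \<in> annulus \<longrightarrow> (AE s in lborel. exp (c * s) * U (flow s x) = (LINT t|lborel. indicator {..<s} t * w x t))"
    by eventually_elim auto
  show ?thesis
    using 1 2
  proof eventually_elim
    case (elim x)
    show ?case
    proof
      assume x: "x \<in> annulus"
      then have prim: "AE s in lborel. exp (c * s) * U (flow s x) = (LINT t|lborel. indicator {..<s} t * w x t)"
        using elim by simp
      have "\<exists>s\<in>{T..T+1}. exp (c * s) * U (flow s x) = (LINT t|lborel. indicator {..<s} t * w x t)"
      proof (rule ccontr)
        assume none: "\<not> ?thesis"
        have "AE s in lborel. s \<notin> {T..T+1}"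
          using prim by eventually_elim (use none in blast)
        then have "{T..T+1} \<in> null_sets lborel"
          by (subst AE_iff_null_sets) auto
        then show False by (auto simp: null_sets_def)
      qed
      then obtain s where s: "s \<in> {T..T+1}" "exp (c * s) * U (flow s x) = (LINT t|lborel. indicator {..<s} t * w x t)"
        by blast
      have "(LINT t|lborel. indicator {..<s} t * w x t) = (LINT t|lborel. w x t)"
        using s(1) w0[OF x] by (intro Bochner_Integration.integral_cong) (auto simp: indicator_def)
      moreover have "T \<le> \<bar>s\<bar>" using s(1) abs_ge_self[of s] by simp
      then have "U (flow s x) = 0" using T[OF x] by (intro U0)
      ultimately have "(LINT t|lborel. w x t) = 0" using s(2) by simp
      then show "integrable lborel (w x) \<and> (LINT t|lborel. w x t) = 0 \<and>
          (AE s in lborel. exp (c * s) * U (flow s x) = (LINT t|lborel. indicator {..<s} t * w x t))"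
        using elim x prim by simp
    qed
  qed
qed

text \<open>The curve in the definition of the radial derivative is the orbit of \<open>x\<close> at the time
\<open>ln r - ln |x|\<close>, which passes through \<open>x\<close> with speed \<open>1 / |x|\<close>.\<close>

lemma radial_deriv_eq_Euler:
  assumes x: "x \<noteq> 0" and f: "f differentiable at x"
  shows "radial_deriv A N f x = Euler f x /\<^sub>R N x"
proof -
  have Nx: "N x > 0" using x by simp
  have ln: "((\<lambda>r. ln r - ln (N x)) has_vector_derivative (1 / N x)) (at (N x))"
    unfolding has_real_derivative_iff_has_vector_derivative[symmetric]
    using Nx by (auto intro!: derivative_eq_intros)
  have "((\<lambda>s. f (flow s x)) has_vector_derivative Euler f (flow 0 x)) (at (ln (N x) - ln (N x)))"
    using has_vector_derivative_along_flow[of f 0 x UNIV] f by simp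
  from vector_diff_chain_at[OF ln this]
  have "((\<lambda>r. f (flow (ln r - ln (N x)) x)) has_vector_derivative Euler f x /\<^sub>R N x) (at (N x))"
    by (simp add: o_def inverse_eq_divide)
  then have "((\<lambda>r. f (dilation A r (dilation A (1 / N x) x))) has_vector_derivative Euler f x /\<^sub>R N x) (at (N x))"
  proof (rule has_vector_derivative_transform_within_open[where S = "{0<..}"])
    fix r :: real assume r: "r \<in> {0<..}"
    have "dilation A r (dilation A (1 / N x) x) = flow (ln r) (flow (- ln (N x)) x)"
      using r Nx by (simp add: flow_def exp_minus inverse_eq_divide)
    then show "f (flow (ln r - ln (N x)) x) = f (dilation A r (dilation A (1 / N x) x))"
      by (simp add: flow_add)
  qed (use Nx in auto)
  then show ?thesis unfolding radial_deriv_def by (rule vector_derivative_at)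
qed

end

section \<open>Borel representatives\<close>

text \<open>Composing with the flow and using Fubini's theorem requires Borel functions, so the Lebesgue measurable
data are replaced by Borel functions that agree with them almost everywhere.\<close>

definition loc_integrable :: "(real ^ 'n::finite \<Rightarrow> real) \<Rightarrow> bool" where
  "loc_integrable u \<longleftrightarrow> u \<in> borel_measurable borel \<and>
     (\<forall>C. compact C \<and> 0 \<notin> C \<longrightarrow> integrable lborel (\<lambda>x. indicator C x * u x))"

lemma loc_integrable_mult:
  fixes u g :: "real ^ 'n::finite \<Rightarrow> real"
  assumes u: "loc_integrable u" and C: "compact C" "0 \<notin> C"
    and g: "continuous_on (- {0}) g" "\<And>x. x \<notin> C \<Longrightarrow> g x = 0"
  shows "integrable lborel (\<lambda>x. u x * g x)" and "g \<in> borel_measurable borel"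
proof -
  have sub: "C \<subseteq> - {0}" using C by auto
  have "(\<lambda>x. indicator (- {0}) x *\<^sub>R g x) \<in> borel_measurable borel"
    using g(1) by (intro borel_measurable_continuous_on_indicator) auto
  also have "(\<lambda>x. indicator (- {0}) x *\<^sub>R g x) = g"
    using g(2) C(2) by (auto simp: fun_eq_iff indicator_def)
  finally show [measurable]: "g \<in> borel_measurable borel" .
  obtain B where B: "\<And>x. x \<in> C \<Longrightarrow> norm (g x) \<le> B"
    using compact_imp_bounded[OF compact_continuous_image[OF continuous_on_subset[OF g(1) sub] C(1)]]
    by (auto simp: bounded_iff)
  have "integrable lborel (\<lambda>x. (indicator C x * u x) * g x)"
    using u C B by (intro integrable_mult_bounded[of lborel _ g B])
      (auto simp: loc_integrable_def indicator_def split: if_splits)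
  also have "(\<lambda>x. (indicator C x * u x) * g x) = (\<lambda>x. u x * g x)"
    using g(2) by (auto simp: fun_eq_iff indicator_def)
  finally show "integrable lborel (\<lambda>x. u x * g x)" .
qed

lemma L1_loc_Borel_version:
  fixes u :: "real ^ 'n::finite \<Rightarrow> real"
  assumes "L1_loc u"
  obtains u0 where "loc_integrable u0" "AE x in lebesgue. u x = u0 x"
proof -
  have "(\<lambda>x. u x * indicator (- {0}) x) \<in> borel_measurable lebesgue"
    using assms borel_measurable_restrict_space_iff[of "- {0}" lebesgue u]
    by (simp add: L1_loc_def mult.commute)
  then obtain u0 where u0: "u0 \<in> borel_measurable borel" "AE x in lborel. u x * indicator (- {0}) x = u0 x"
    using completion_ex_borel_measurable_real[of "\<lambda>x. u x * indicator (- {0}) x" lborel] by auto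
  have "AE x in lborel. x \<noteq> (0 :: real ^ 'n)" by (rule AE_lborel_singleton)
  with u0(2) have "AE x in lborel. u x = u0 x"
    by eventually_elim (auto simp: indicator_def)
  then have ae: "AE x in lebesgue. u x = u0 x" by (rule AE_completion)
  have "integrable lborel (\<lambda>x. indicator C x * u0 x)" if C: "compact C" "0 \<notin> C" for C
  proof -
    have [measurable]: "C \<in> sets borel" using C(1) by (simp add: compact_imp_closed)
    have "integrable lebesgue (\<lambda>x. indicator C x *\<^sub>R u x)"
      using assms C by (auto simp: L1_loc_def set_integrable_def)
    moreover have "(\<lambda>x. indicator C x * u0 x) \<in> borel_measurable lebesgue"
      using u0(1) by (intro measurable_completion) simp
    ultimately have "integrable lebesgue (\<lambda>x. indicator C x * u0 x)"
      by (rule integrable_cong_AE_imp) (use ae in eventually_elim, auto)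
    then show ?thesis
      using u0(1) by (subst (asm) integrable_completion) auto
  qed
  with u0(1) have "loc_integrable u0" by (auto simp: loc_integrable_def)
  then show ?thesis using ae by (rule that)
qed

lemma loc_integrable_mult_L2:
  fixes u v :: "real ^ 'n::finite \<Rightarrow> real"
  assumes [measurable]: "u \<in> borel_measurable borel" "v \<in> borel_measurable borel"
    and u: "loc_integrable (\<lambda>x. (u x)\<^sup>2)" and v: "loc_integrable (\<lambda>x. (v x)\<^sup>2)"
  shows "loc_integrable (\<lambda>x. u x * v x)"
  unfolding loc_integrable_def
proof (intro conjI allI impI)
  fix C :: "(real ^ 'n) set" assume C: "compact C \<and> 0 \<notin> C"
  then have [measurable]: "C \<in> sets borel" by (simp add: compact_imp_closed)
  have "integrable lborel (\<lambda>x. indicator C x * (u x)\<^sup>2 + indicator C x * (v x)\<^sup>2)"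
    using u v C by (intro Bochner_Integration.integrable_add) (auto simp: loc_integrable_def)
  then show "integrable lborel (\<lambda>x. indicator C x * (u x * v x))"
  proof (rule Bochner_Integration.integrable_bound)
    have "\<bar>a * b\<bar> \<le> a\<^sup>2 + b\<^sup>2" for a b :: real
    proof -
      have "2 * \<bar>a\<bar> * \<bar>b\<bar> \<le> \<bar>a\<bar>\<^sup>2 + \<bar>b\<bar>\<^sup>2" by (rule sum_squares_bound)
      moreover have "0 \<le> \<bar>a\<bar> * \<bar>b\<bar>" by simp
      ultimately show ?thesis unfolding abs_mult power2_abs by linarith
    qed
    then show "AE x in lborel. norm (indicator C x * (u x * v x)) \<le> norm (indicator C x * (u x)\<^sup>2 + indicator C x * (v x)\<^sup>2)"
      by (intro AE_I2) (auto simp: indicator_def)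
  qed measurable
qed measurable

lemma L2_loc_Borel_version:
  fixes u :: "real ^ 'n::finite \<Rightarrow> real"
  assumes u: "L2_loc u" and ae: "AE x in lebesgue. u x = u0 x" and [measurable]: "u0 \<in> borel_measurable borel"
  shows "loc_integrable (\<lambda>x. (u0 x)\<^sup>2)"
  unfolding loc_integrable_def
proof (intro conjI allI impI)
  fix C :: "(real ^ 'n) set" assume C: "compact C \<and> 0 \<notin> C"
  then have [measurable]: "C \<in> sets borel" by (simp add: compact_imp_closed)
  have "integrable lebesgue (\<lambda>x. indicator C x *\<^sub>R (u x)\<^sup>2)"
    using u C by (auto simp: L2_loc_def set_integrable_def)
  moreover have "(\<lambda>x. indicator C x * (u0 x)\<^sup>2) \<in> borel_measurable lebesgue"
    by (intro measurable_completion) simp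
  ultimately have "integrable lebesgue (\<lambda>x. indicator C x * (u0 x)\<^sup>2)"
    by (rule integrable_cong_AE_imp) (use ae in eventually_elim, auto)
  then show "integrable lborel (\<lambda>x. indicator C x * (u0 x)\<^sup>2)"
    by (subst (asm) integrable_completion) auto
qed measurable

lemma integral_lebesgue_Borel_version:
  fixes F F0 :: "real ^ 'n::finite \<Rightarrow> real"
  assumes "F0 \<in> borel_measurable borel" "AE x in lebesgue. F x = F0 x"
  shows "(LINT x|lebesgue. F x) = (LINT x|lborel. F0 x)"
proof -
  have F0: "F0 \<in> borel_measurable lebesgue"
    using assms(1) by (intro measurable_completion) simp
  then have "F \<in> borel_measurable lebesgue"
    by (rule borel_measurable_AE) (use assms(2) in \<open>auto elim: eventually_mono\<close>)
  then have "(LINT x|lebesgue. F x) = (LINT x|lebesgue. F0 x)"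
    using F0 assms(2) by (intro integral_cong_AE)
  also have "\<dots> = (LINT x|lborel. F0 x)"
    using assms(1) by (intro integral_completion) simp
  finally show ?thesis .
qed

context quasi_norm_flow
begin

text \<open>The weak radial derivative of Borel functions, with \<open>R\<close> and the quotient \<open>(Q - 1) / |x|\<close> in its adjoint
expressed through the smooth operator \<open>E\<close>.\<close>

definition weak_deriv :: "(real ^ 'n \<Rightarrow> real) \<Rightarrow> (real ^ 'n \<Rightarrow> real) \<Rightarrow> bool" where
  "weak_deriv u v \<longleftrightarrow> loc_integrable u \<and> loc_integrable v \<and>
     (\<forall>\<eta>. test_function \<eta> \<longrightarrow>
        (LINT x|lborel. v x * \<eta> x) = - (LINT x|lborel. u x * ((Euler \<eta> x + (Q - 1) * \<eta> x) / N x)))"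

lemma continuous_on_N: "continuous_on S N"
  using continuous_N by (rule continuous_on_subset) simp

lemma test_function_continuous:
  assumes "test_function f"
  shows "continuous_on S f" "continuous_on S (Euler f)"
proof -
  have "continuous_on UNIV f"
    using test_function_differentiable[OF assms]
    by (simp add: continuous_on_eq_continuous_within differentiable_imp_continuous_within)
  then show "continuous_on S f" by (rule continuous_on_subset) simp
  have "continuous_on UNIV (Euler f)"
    using test_function_differentiable[OF assms] test_function_frechet_derivative_continuous[OF assms]
    by (rule continuous_on_Euler)
  then show "continuous_on S (Euler f)" by (rule continuous_on_subset) simp
qed

lemma Euler_outside:
  assumes "test_function f" "x \<notin> closure {x. f x \<noteq> 0}"
  shows "Euler f x = 0"
  using test_function_frechet_derivative_outside[OF assms] by (simp add: Euler_def)

lemma test_function_outside: "x \<notin> closure {x. f x \<noteq> 0} \<Longrightarrow> f x = 0"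
  using closure_subset[of "{x. f x \<noteq> 0}"] by blast

lemma Euler_mult:
  fixes f g :: "real ^ 'n \<Rightarrow> real"
  assumes "f differentiable at x" "g differentiable at x"
  shows "Euler (\<lambda>x. f x * g x) x = f x * Euler g x + Euler f x * g x"
proof -
  have "((\<lambda>x. f x * g x) has_derivative (\<lambda>v. f x * frechet_derivative g (at x) v + frechet_derivative f (at x) v * g x)) (at x)"
    using assms by (intro has_derivative_mult) (auto simp: frechet_derivative_works)
  from frechet_derivative_at[OF this, symmetric] show ?thesis by (simp add: Euler_def)
qed

lemma has_weak_radial_deriv_Borel:
  assumes "has_weak_radial_deriv A N u v"
    and "loc_integrable u0" "AE x in lebesgue. u x = u0 x"
    and "loc_integrable v0" "AE x in lebesgue. v x = v0 x"
  shows "weak_deriv u0 v0"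
  unfolding weak_deriv_def
proof (intro conjI allI impI)
  fix \<eta> :: "real ^ 'n \<Rightarrow> real" assume \<eta>: "test_function \<eta>"
  have [measurable]: "u0 \<in> borel_measurable borel" "v0 \<in> borel_measurable borel"
    using assms by (auto simp: loc_integrable_def)
  have [measurable]: "\<eta> \<in> borel_measurable borel" "Euler \<eta> \<in> borel_measurable borel"
    using test_function_continuous[OF \<eta>] by (auto intro: borel_measurable_continuous_onI)
  have "(LINT x|lborel. v0 x * \<eta> x) = (LINT x|lebesgue. v x * \<eta> x)"
    by (rule integral_lebesgue_Borel_version[symmetric]) (use assms(5) in \<open>auto elim: eventually_mono\<close>)
  also have "\<dots> = (LINT x|lebesgue. u x * radial_adjoint A N \<eta> x)"
    using assms(1) \<eta> by (simp add: has_weak_radial_deriv_def)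
  also have "\<dots> = (LINT x|lborel. u0 x * (- ((Euler \<eta> x + (Q - 1) * \<eta> x) / N x)))"
  proof (rule integral_lebesgue_Borel_version)
    have "AE x in lebesgue. x \<noteq> (0 :: real ^ 'n)"
      by (intro AE_completion AE_lborel_singleton)
    with assms(3) show "AE x in lebesgue. u x * radial_adjoint A N \<eta> x = u0 x * (- ((Euler \<eta> x + (Q - 1) * \<eta> x) / N x))"
    proof eventually_elim
      case (elim x)
      then show ?case
        using radial_deriv_eq_Euler[OF elim(2) test_function_differentiable[OF \<eta>]]
        by (simp add: radial_adjoint_def divide_simps algebra_simps)
    qed
  qed measurable
  finally show "(LINT x|lborel. v0 x * \<eta> x) = - (LINT x|lborel. u0 x * ((Euler \<eta> x + (Q - 1) * \<eta> x) / N x))"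
    by simp
qed (use assms in auto)

end

section \<open>Integration by parts\<close>

context quasi_norm_flow
begin

text \<open>The localization of \<open>u / |x|\<close> by \<open>h\<close>, and the derivative that it should have along the flow: as
\<open>E u = |x| u'\<close> and \<open>E |x| = |x|\<close>, formally \<open>E (u / |x|) = u' - u / |x|\<close>.\<close>

definition cut :: "(real ^ 'n \<Rightarrow> real) \<Rightarrow> (real ^ 'n \<Rightarrow> real) \<Rightarrow> real ^ 'n \<Rightarrow> real" where
  "cut h u x = h x * u x / N x"

definition cut_deriv :: "(real ^ 'n \<Rightarrow> real) \<Rightarrow> (real ^ 'n \<Rightarrow> real) \<Rightarrow> (real ^ 'n \<Rightarrow> real) \<Rightarrow> real ^ 'n \<Rightarrow> real" where
  "cut_deriv h u u' x = h x * u' x + u x / N x * (Euler h x - h x)"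

text \<open>Since \<open>h p\<close> is a test function for every polynomial \<open>p\<close>, the weak identity for \<open>u\<close> can be applied to
it. Because \<open>1 / |x|\<close> stays with \<open>u\<close>, no derivative falls on the quasi-norm.\<close>

lemma localized_weak_deriv:
  fixes u u' h :: "real ^ 'n \<Rightarrow> real"
  defines "C \<equiv> closure {x. h x \<noteq> 0}"
    and "U \<equiv> cut h u" and "W \<equiv> cut_deriv h u u'"
  assumes u: "weak_deriv u u'" and h: "test_function h"
  shows "integrable lborel U" "integrable lborel W"
    "\<And>x. x \<notin> C \<Longrightarrow> U x = 0" "\<And>x. x \<notin> C \<Longrightarrow> W x = 0"
    "\<And>p. real_polynomial_function p \<Longrightarrow>
      (LINT x|lborel. W x * p x) = - (LINT x|lborel. U x * (Euler p x + Q * p x))"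
proof -
  have U_def: "U = (\<lambda>x. h x * u x / N x)"
    and W_def: "W = (\<lambda>x. h x * u' x + u x / N x * (Euler h x - h x))"
    by (simp_all add: fun_eq_iff U_def W_def cut_def cut_deriv_def)
  have C: "compact C" "0 \<notin> C" using h by (auto simp: C_def test_function_def)
  have lu: "loc_integrable u" "loc_integrable u'" using u by (auto simp: weak_deriv_def)
  have h0: "h x = 0" "Euler h x = 0" if "x \<notin> C" for x
    using that test_function_outside[of x h] Euler_outside[OF h] by (auto simp: C_def)
  note ci = continuous_intros test_function_continuous[OF h] continuous_on_N
  have "integrable lborel (\<lambda>x. u x * (h x / N x))"
    by (rule loc_integrable_mult[OF lu(1) C]) (auto intro!: ci simp: h0)
  then show "integrable lborel U" by (simp add: U_def mult.commute)
  have "integrable lborel (\<lambda>x. u' x * h x)"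
    by (rule loc_integrable_mult[OF lu(2) C]) (auto intro!: ci simp: h0)
  moreover have "integrable lborel (\<lambda>x. u x * ((Euler h x - h x) / N x))"
    by (rule loc_integrable_mult[OF lu(1) C]) (auto intro!: ci simp: h0)
  ultimately show "integrable lborel W"
    by (simp add: W_def mult.commute)
  show "U x = 0" "W x = 0" if "x \<notin> C" for x
    using h0[OF that] by (simp_all add: U_def W_def)
  fix p :: "real ^ 'n \<Rightarrow> real" assume p: "real_polynomial_function p"
  have pc: "continuous_on S p" "continuous_on S (Euler p)" for S
    using continuous_on_Euler_polynomial[OF p] p
    by (auto simp: continuous_on_polymonial_function real_polynomial_function_eq intro: continuous_on_subset)
  have pd: "p differentiable at x" for x
    using p by (rule differentiable_at_real_polynomial_function)
  have i1: "integrable lborel (\<lambda>x. u' x * (h x * p x))"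
    by (rule loc_integrable_mult[OF lu(2) C]) (auto intro!: ci pc simp: h0)
  have i2: "integrable lborel (\<lambda>x. u x * ((Euler h x - h x) / N x * p x))"
    by (rule loc_integrable_mult[OF lu(1) C]) (auto intro!: ci pc simp: h0)
  have i3: "integrable lborel (\<lambda>x. u x * ((h x * Euler p x + Euler h x * p x + (Q - 1) * (h x * p x)) / N x))"
    by (rule loc_integrable_mult[OF lu(1) C]) (auto intro!: ci pc simp: h0)
  have "(LINT x|lborel. W x * p x) = (LINT x|lborel. u' x * (h x * p x) + u x * ((Euler h x - h x) / N x * p x))"
    by (intro Bochner_Integration.integral_cong) (auto simp: W_def algebra_simps diff_divide_distrib add_divide_distrib)
  also have "\<dots> = (LINT x|lborel. u' x * (h x * p x)) + (LINT x|lborel. u x * ((Euler h x - h x) / N x * p x))"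
    using i1 i2 by simp
  also have "(LINT x|lborel. u' x * (h x * p x))
      = - (LINT x|lborel. u x * ((h x * Euler p x + Euler h x * p x + (Q - 1) * (h x * p x)) / N x))"
    using u test_function_mult_polynomial[OF h p] Euler_mult[OF test_function_differentiable[OF h] pd]
    by (simp add: weak_deriv_def)
  also have "- (LINT x|lborel. u x * ((h x * Euler p x + Euler h x * p x + (Q - 1) * (h x * p x)) / N x))
        + (LINT x|lborel. u x * ((Euler h x - h x) / N x * p x))
      = (LINT x|lborel. - (u x * ((h x * Euler p x + Euler h x * p x + (Q - 1) * (h x * p x)) / N x))
        + u x * ((Euler h x - h x) / N x * p x))"
    using i2 i3 by simp
  also have "\<dots> = (LINT x|lborel. - (U x * (Euler p x + Q * p x)))"
    by (intro Bochner_Integration.integral_cong refl) (simp add: U_def diff_divide_distrib add_divide_distrib algebra_simps)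
  finally show "(LINT x|lborel. W x * p x) = - (LINT x|lborel. U x * (Euler p x + Q * p x))"
    by simp
qed

text \<open>Formally \<open>|x|\<^bsup>j-1\<^esup> J\<close> is the derivative \<open>(E + 2 c) (U\<^sub>1 U\<^sub>2)\<close> of the product of the localizations
\<open>U\<^sub>1 = h u / |x|\<close> and \<open>U\<^sub>2 = h v / |x|\<close>, where \<open>2 c = Q + 1 - j\<close>. Along the orbit of \<open>x\<close> the polar
density \<open>exp (s Q) J\<close> is thus a constant times the derivative of the product of
\<open>exp (c s) U\<^sub>1\<close> and \<open>exp (c s) U\<^sub>2\<close>, two primitives with total increment zero.\<close>

lemma weighted_product_rule:
  fixes u u' v v' h :: "real ^ 'n \<Rightarrow> real" and j :: nat
  defines "J \<equiv> \<lambda>x. ((u' x * v x + u x * v' x) * (h x)\<^sup>2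
      + u x * v x * ((2 * h x * Euler h x + (Q - 1 - real j) * (h x)\<^sup>2) / N x)) / N x ^ j"
  assumes u: "weak_deriv u u'" and v: "weak_deriv v v'" and h: "test_function h"
    and u'v: "integrable lborel (\<lambda>x. u' x * v x * (h x)\<^sup>2)"
    and uv': "integrable lborel (\<lambda>x. u x * v' x * (h x)\<^sup>2)"
    and uv: "loc_integrable (\<lambda>x. u x * v x)"
  shows "integrable lborel J" "(LINT x|lborel. J x) = 0"
proof -
  define C where "C = closure {x. h x \<noteq> 0}"
  have C: "compact C" "0 \<notin> C" using h by (auto simp: C_def test_function_def)
  have h0: "h x = 0" "Euler h x = 0" if "x \<notin> C" for x
    using that test_function_outside[of x h] Euler_outside[OF h] by (auto simp: C_def)
  note ci = continuous_intros test_function_continuous[OF h] continuous_on_N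
  define U where "U = cut h"
  define W where "W = cut_deriv h"
  note loc_u = localized_weak_deriv[OF u h, folded C_def U_def W_def]
  note loc_v = localized_weak_deriv[OF v h, folded C_def U_def W_def]
  obtain m where m: "m > 0" "\<And>x. x \<in> C \<Longrightarrow> m \<le> N x"
  proof (cases "C = {}")
    case False
    obtain a where a: "a \<in> C" "\<And>y. y \<in> C \<Longrightarrow> N a \<le> N y"
      using continuous_attains_inf[OF C(1) False continuous_on_N] by auto
    then have "a \<noteq> 0" using C(2) by auto
    then show ?thesis using that[of "N a"] a by simp
  qed (use that[of 1] in auto)
  have bound: "integrable lborel (\<lambda>x. k x * (1 / N x ^ j))"
    if k: "integrable lborel k" and k0: "\<And>x. x \<notin> C \<Longrightarrow> k x = 0" for k
  proof (rule integrable_mult_bounded[OF k])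
    fix x assume "k x \<noteq> 0"
    then have "m \<le> N x" using k0 m(2) by blast
    then have "m ^ j \<le> N x ^ j" using m(1) by (intro power_mono) auto
    then have "1 / N x ^ j \<le> 1 / m ^ j" using m(1) by (simp add: frac_le)
    then show "\<bar>1 / N x ^ j\<bar> \<le> 1 / m ^ j" using N_nonneg[of x] by simp
  qed simp
  have i1: "integrable lborel (\<lambda>x. (u' x * v x * (h x)\<^sup>2 + u x * v' x * (h x)\<^sup>2) * (1 / N x ^ j))"
    using u'v uv' by (intro bound) (auto simp: h0)
  have i2: "integrable lborel (\<lambda>x. (u x * v x) * ((2 * h x * Euler h x + (Q - 1 - real j) * (h x)\<^sup>2) / N x / N x ^ j))"
    by (rule loc_integrable_mult[OF uv C]) (auto intro!: ci simp: h0)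
  show Ji: "integrable lborel J"
    using Bochner_Integration.integrable_add[OF i1 i2] unfolding J_def
    by (rule back_subst[where P = "integrable lborel"]) (simp add: fun_eq_iff add_divide_distrib algebra_simps)
  define c where "c = (Q + 1 - real j) / 2"
  show "(LINT x|lborel. J x) = 0"
  proof (rule integral_eq_0_if_orbit_integrals_eq_0[OF Ji])
    have prim: "AE x in lborel. x \<in> annulus \<longrightarrow>
        integrable lborel (\<lambda>t. exp (c * t) * (W k k' (flow t x) + c * U k (flow t x))) \<and>
        (LINT t|lborel. exp (c * t) * (W k k' (flow t x) + c * U k (flow t x))) = 0 \<and>
        (AE s in lborel. exp (c * s) * U k (flow s x) =
          (LINT t|lborel. indicator {..<s} t * (exp (c * t) * (W k k' (flow t x) + c * U k (flow t x)))))"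
      if "weak_deriv k k'" for k k'
      using localized_weak_deriv[OF that h, folded C_def U_def W_def] C by (intro orbit_primitive)
    show "AE x in lborel. x \<in> annulus \<longrightarrow> (LINT s|lborel. exp (s * Q) * J (flow s x)) = 0"
      using prim[OF u] prim[OF v]
    proof eventually_elim
      case (elim x)
      show ?case
      proof
        assume x: "x \<in> annulus"
        then have "N x > 0" by (auto simp: annulus_def simp del: N_pos)
        then have x0: "x \<noteq> 0" by simp
        let ?w = "\<lambda>t. exp (c * t) * (W u u' (flow t x) + c * U u (flow t x))"
        let ?z = "\<lambda>t. exp (c * t) * (W v v' (flow t x) + c * U v (flow t x))"
        let ?Iw = "\<lambda>s. LINT t|lborel. indicator {..<s} t * ?w t"
        let ?Iz = "\<lambda>s. LINT t|lborel. indicator {..<s} t * ?z t"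
        have w: "integrable lborel ?w" "(LINT t|lborel. ?w t) = 0" "AE s in lborel. exp (c * s) * U u (flow s x) = ?Iw s"
          and z: "integrable lborel ?z" "AE s in lborel. exp (c * s) * U v (flow s x) = ?Iz s"
          using elim x by auto
        have "exp (s * Q) * J (flow s x) = N x / N x ^ j *
            (?w s * (exp (c * s) * U v (flow s x)) + (exp (c * s) * U u (flow s x)) * ?z s)" for s
        proof -
          define y n where "y = flow s x" and "n = N y"
          have n: "n > 0" using x0 by (simp add: n_def y_def)
          define a b where "a = u y / n" and "b = v y / n"
          have ab: "u y = n * a" "v y = n * b" using n by (simp_all add: a_def b_def)
          let ?K = "(W u u' y + c * U u y) * U v y + U u y * (W v v' y + c * U v y)"
          have UW: "U u y = h y * a" "U v y = h y * b"
            "W u u' y = h y * u' y + a * (Euler h y - h y)" "W v v' y = h y * v' y + b * (Euler h y - h y)"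
            by (simp_all add: U_def W_def cut_def cut_deriv_def a_def b_def n_def)
          have "J y = (n * ((u' y * b + a * v' y) * (h y)\<^sup>2 + a * b * (2 * h y * Euler h y + (Q - 1 - real j) * (h y)\<^sup>2))) / n ^ j"
          proof -
            have "n * a * (n * b) * (X / n) = n * (a * b * X)" for X using n by simp
            then show ?thesis
              unfolding J_def n_def[symmetric] ab by (simp only:) (simp add: algebra_simps)
          qed
          also have "(u' y * b + a * v' y) * (h y)\<^sup>2 + a * b * (2 * h y * Euler h y + (Q - 1 - real j) * (h y)\<^sup>2) = ?K"
            unfolding UW c_def by (simp add: field_simps power2_eq_square)
          finally have J: "J y = n / n ^ j * ?K" by simp
          have e: "exp (s * Q) * (exp s / exp s ^ j) = exp (c * s) * exp (c * s)"
            unfolding exp_of_nat_mult[symmetric] exp_add[symmetric] exp_diff[symmetric]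
            by (rule arg_cong[where f = exp]) (simp add: c_def field_simps)
          have n_pow: "exp (s * Q) * (n / n ^ j) = (exp (s * Q) * (exp s / exp s ^ j)) * (N x / N x ^ j)"
            unfolding n_def y_def N_flow power_mult_distrib by simp
          have "exp (s * Q) * J y = (exp (s * Q) * (n / n ^ j)) * ?K"
            unfolding J by (simp only: mult.assoc)
          also have "\<dots> = (exp (c * s) * exp (c * s)) * (N x / N x ^ j) * ?K"
            unfolding n_pow e ..
          also have "\<dots> = N x / N x ^ j * ((exp (c * s) * (W u u' y + c * U u y)) * (exp (c * s) * U v y)
              + (exp (c * s) * U u y) * (exp (c * s) * (W v v' y + c * U v y)))"
            by algebra
          finally show ?thesis unfolding y_def .
        qed
        then have "(LINT s|lborel. exp (s * Q) * J (flow s x)) = (LINT s|lborel. N x / N x ^ j *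
            (?w s * (exp (c * s) * U v (flow s x)) + (exp (c * s) * U u (flow s x)) * ?z s))"
          by simp
        also have "\<dots> = (LINT s|lborel. N x / N x ^ j * (?w s * ?Iz s + ?Iw s * ?z s))"
        proof (rule integral_cong_AE)
          have [measurable]: "U u \<in> borel_measurable borel" "U v \<in> borel_measurable borel"
            "W u u' \<in> borel_measurable borel" "W v v' \<in> borel_measurable borel"
            using loc_u(1,2) loc_v(1,2) by auto
          show "(\<lambda>s. N x / N x ^ j * (?w s * (exp (c * s) * U v (flow s x)) + (exp (c * s) * U u (flow s x)) * ?z s)) \<in> borel_measurable lborel"
            by measurable
          show "(\<lambda>s. N x / N x ^ j * (?w s * ?Iz s + ?Iw s * ?z s)) \<in> borel_measurable lborel"
            by (rule borel_measurable_times[OF borel_measurable_const borel_measurable_integrable[OF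
              Bochner_Integration.integrable_add[OF integral_mult_primitives(2,3)[OF w(1) z(1)]]]])
          show "AE s in lborel. N x / N x ^ j * (?w s * (exp (c * s) * U v (flow s x)) + (exp (c * s) * U u (flow s x)) * ?z s)
             = N x / N x ^ j * (?w s * ?Iz s + ?Iw s * ?z s)"
            using w(3) z(2) by eventually_elim simp
        qed
        also have "\<dots> = N x / N x ^ j * ((LINT t|lborel. ?w t) * (LINT t|lborel. ?z t))"
          by (simp only: integral_mult_right_zero integral_mult_primitives(1)[OF w(1) z(1)])
        also have "\<dots> = 0" using w(2) by simp
        finally show "(LINT s|lborel. exp (s * Q) * J (flow s x)) = 0" .
      qed
    qed
  qed
qed

end

section \<open>The two inequalities\<close>

context quasi_norm_flow
begin

text \<open>Since \<open>|f|\<^sup>2\<close> is the sum of the squares of the real and the imaginary part of \<open>f\<close>, the rule for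
squares of real test functions is enough.\<close>

lemma weighted_product_rule_complex:
  fixes u u' v v' :: "real ^ 'n \<Rightarrow> real" and f :: "real ^ 'n \<Rightarrow> complex" and j :: nat
  assumes u: "weak_deriv u u'" and v: "weak_deriv v v'" and f: "test_function f"
    and u'v: "integrable lborel (\<lambda>x. u' x * v x * (norm (f x))\<^sup>2)"
    and uv': "integrable lborel (\<lambda>x. u x * v' x * (norm (f x))\<^sup>2)"
    and uv: "loc_integrable (\<lambda>x. u x * v x)"
  shows "(LINT x|lborel. ((u' x * v x + u x * v' x) * (norm (f x))\<^sup>2
      + u x * v x * ((2 * (f x \<bullet> Euler f x) + (Q - 1 - real j) * (norm (f x))\<^sup>2) / N x)) / N x ^ j) = 0"
proof -
  let ?J = "\<lambda>h x. ((u' x * v x + u x * v' x) * (h x)\<^sup>2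
      + u x * v x * ((2 * h x * Euler h x + (Q - 1 - real j) * (h x)\<^sup>2) / N x)) / N x ^ j"
  have re: "test_function (\<lambda>x. Re (f x))" and im: "test_function (\<lambda>x. Im (f x))"
    using test_function_bounded_linear[OF bounded_linear_Re f] test_function_bounded_linear[OF bounded_linear_Im f] by auto
  have Euler_part: "Euler (\<lambda>x. L (f x)) x = L (Euler f x)" if "bounded_linear L" for L :: "complex \<Rightarrow> real" and x
  proof -
    have "(f has_derivative frechet_derivative f (at x)) (at x)"
      using test_function_differentiable[OF f] by (simp add: frechet_derivative_works)
    from bounded_linear.has_derivative[OF that this] show ?thesis
      unfolding Euler_def by (metis frechet_derivative_at)
  qed
  have [measurable]: "f \<in> borel_measurable borel" 
    using test_function_continuous[OF f] by (auto intro: borel_measurable_continuous_onI)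
  have [measurable]: "u \<in> borel_measurable borel" "v \<in> borel_measurable borel"
      "u' \<in> borel_measurable borel" "v' \<in> borel_measurable borel"
    using u v by (auto simp: weak_deriv_def loc_integrable_def)
  have dom: "integrable lborel (\<lambda>x. k x * (h x)\<^sup>2)"
    if k: "integrable lborel (\<lambda>x. k x * (norm (f x))\<^sup>2)" and [measurable]: "k \<in> borel_measurable borel" "h \<in> borel_measurable borel"
      and h: "\<And>x. \<bar>h x\<bar> \<le> norm (f x)" for k h :: "real ^ 'n \<Rightarrow> real"
  proof (rule Bochner_Integration.integrable_bound[OF k])
    have "(h x)\<^sup>2 \<le> (norm (f x))\<^sup>2" for x using h[of x] by (metis abs_ge_zero power2_abs power_mono)
    then show "AE x in lborel. norm (k x * (h x)\<^sup>2) \<le> norm (k x * (norm (f x))\<^sup>2)"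
      by (intro AE_I2) (simp add: abs_mult mult_left_mono)
  qed measurable
  have R: "integrable lborel (?J (\<lambda>x. Re (f x)))" "(LINT x|lborel. ?J (\<lambda>x. Re (f x)) x) = 0"
    and I: "integrable lborel (?J (\<lambda>x. Im (f x)))" "(LINT x|lborel. ?J (\<lambda>x. Im (f x)) x) = 0"
    using weighted_product_rule[OF u v re _ _ uv, of j] weighted_product_rule[OF u v im _ _ uv, of j]
      dom[OF u'v] dom[OF uv'] abs_Re_le_cmod abs_Im_le_cmod by auto
  have "(LINT x|lborel. ((u' x * v x + u x * v' x) * (norm (f x))\<^sup>2
      + u x * v x * ((2 * (f x \<bullet> Euler f x) + (Q - 1 - real j) * (norm (f x))\<^sup>2) / N x)) / N x ^ j)
    = (LINT x|lborel. ?J (\<lambda>x. Re (f x)) x + ?J (\<lambda>x. Im (f x)) x)"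
    unfolding Euler_part[OF bounded_linear_Re] Euler_part[OF bounded_linear_Im]
    by (intro Bochner_Integration.integral_cong refl)
      (simp add: cmod_power2 inner_complex_def algebra_simps add_divide_distrib diff_divide_distrib)
  also have "\<dots> = 0" using R I by simp
  finally show ?thesis .
qed

lemma radial_adjoint_norm_square:
  fixes f :: "real ^ 'n \<Rightarrow> complex"
  assumes f: "f differentiable at x" and x: "x \<noteq> 0"
  shows "radial_adjoint A N (\<lambda>x. (norm (f x))\<^sup>2) x
    = - (2 * (f x \<bullet> Euler f x) / N x) - (Q - 1) * ((norm (f x))\<^sup>2 / N x)"
proof -
  have d: "((\<lambda>x. (norm (f x))\<^sup>2) has_derivative (\<lambda>v. 2 * (f x \<bullet> frechet_derivative f (at x) v))) (at x)"
    unfolding power2_norm_eq_inner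
    using has_derivative_inner[of f "frechet_derivative f (at x)" x UNIV f "frechet_derivative f (at x)"] f
    by (simp add: frechet_derivative_works inner_commute)
  then have "Euler (\<lambda>x. (norm (f x))\<^sup>2) x = 2 * (f x \<bullet> Euler f x)"
    unfolding Euler_def by (metis frechet_derivative_at)
  moreover have diff: "(\<lambda>x. (norm (f x))\<^sup>2) differentiable at x"
    using d by (auto simp: differentiable_def)
  ultimately show ?thesis
    using radial_deriv_eq_Euler[OF x diff] x by (simp add: radial_adjoint_def divide_inverse mult.commute mult.left_commute)
qed

text \<open>The letters \<open>X1, ..., Z\<close> in the proof name the integrals that arise when the squares are expanded; \<open>g\<close> is
\<open>|f|\<^sup>2\<close> and \<open>D\<close> is \<open>E |f|\<^sup>2\<close>. The identities \<open>PR1\<close> and \<open>PR2\<close> are the product rules for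
\<open>\<phi> \<psi>\<close> and for \<open>\<phi>\<^sup>2 / |x|\<close>.\<close>

theorem radial_inequalities:
  fixes \<phi> \<psi> R\<phi> R\<psi> :: "real ^ 'n \<Rightarrow> real" and \<alpha> :: real and f :: "real ^ 'n \<Rightarrow> complex"
  assumes L2: "L2_loc \<phi>" "L2_loc \<psi>" "L2_loc R\<phi>" "L2_loc R\<psi>"
    and weak: "has_weak_radial_deriv A N \<phi> R\<phi>" "has_weak_radial_deriv A N \<psi> R\<psi>"
    and f: "test_function f"
  shows "(LINT x|lebesgue. (\<phi> x)\<^sup>2 * (norm (radial_deriv A N f x))\<^sup>2)
      \<ge> \<alpha> * (LINT x|lebesgue. (\<phi> x * R\<psi> x + \<psi> x * R\<phi> x) * (norm (f x))\<^sup>2)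
        + \<alpha> * (Q - 1) * (LINT x|lebesgue. \<phi> x * \<psi> x / N x * (norm (f x))\<^sup>2)
        - \<alpha>\<^sup>2 * (LINT x|lebesgue. (\<psi> x)\<^sup>2 * (norm (f x))\<^sup>2)" (is ?first)
    and "(LINT x|lebesgue. (\<phi> x)\<^sup>2 * (norm (radial_deriv A N f x))\<^sup>2)
      \<ge> \<alpha> * (LINT x|lebesgue. (\<psi> x * R\<phi> x - \<phi> x * R\<psi> x) * (norm (f x))\<^sup>2)
        + \<alpha> * (Q - 1) * (LINT x|lebesgue. \<phi> x * \<psi> x / N x * (norm (f x))\<^sup>2)
        - \<alpha>\<^sup>2 * (LINT x|lebesgue. (\<psi> x)\<^sup>2 * (norm (f x))\<^sup>2)
        - (Q - 1) * (LINT x|lebesgue. (\<phi> x)\<^sup>2 / (N x)\<^sup>2 * (norm (f x))\<^sup>2)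
        + (Q - 1) * (LINT x|lebesgue. \<phi> x * R\<phi> x / N x * (norm (f x))\<^sup>2)
        + radial_pairing A N \<phi> R\<phi> R\<phi> (\<lambda>x. (norm (f x))\<^sup>2)" (is ?second)
proof -
  obtain p where p: "loc_integrable p" "AE x in lebesgue. \<phi> x = p x"
    using L1_loc_Borel_version weak(1) by (auto simp: has_weak_radial_deriv_def)
  obtain q where q: "loc_integrable q" "AE x in lebesgue. \<psi> x = q x"
    using L1_loc_Borel_version weak(2) by (auto simp: has_weak_radial_deriv_def)
  obtain p' where p': "loc_integrable p'" "AE x in lebesgue. R\<phi> x = p' x"
    using L1_loc_Borel_version weak(1) by (auto simp: has_weak_radial_deriv_def)
  obtain q' where q': "loc_integrable q'" "AE x in lebesgue. R\<psi> x = q' x"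
    using L1_loc_Borel_version weak(2) by (auto simp: has_weak_radial_deriv_def)
  have wp: "weak_deriv p p'" and wq: "weak_deriv q q'"
    using has_weak_radial_deriv_Borel[OF weak(1) p p'] has_weak_radial_deriv_Borel[OF weak(2) q q'] .
  have bm [measurable]: "p \<in> borel_measurable borel" "q \<in> borel_measurable borel"
      "p' \<in> borel_measurable borel" "q' \<in> borel_measurable borel"
    using p q p' q' by (auto simp: loc_integrable_def)
  have sq: "loc_integrable (\<lambda>x. (p x)\<^sup>2)" "loc_integrable (\<lambda>x. (q x)\<^sup>2)"
      "loc_integrable (\<lambda>x. (p' x)\<^sup>2)" "loc_integrable (\<lambda>x. (q' x)\<^sup>2)"
    using L2_loc_Borel_version[OF L2(1) p(2)] L2_loc_Borel_version[OF L2(2) q(2)]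
      L2_loc_Borel_version[OF L2(3) p'(2)] L2_loc_Borel_version[OF L2(4) q'(2)] by auto
  note L = loc_integrable_mult_L2[OF _ _ sq(1) sq(2)] loc_integrable_mult_L2[OF _ _ sq(1) sq(3)]
    loc_integrable_mult_L2[OF _ _ sq(1) sq(4)] loc_integrable_mult_L2[OF _ _ sq(2) sq(3)]
  define C where "C = closure {x. f x \<noteq> 0}"
  have C: "compact C" "0 \<notin> C" using f by (auto simp: C_def test_function_def)
  have f0: "f x = 0" "Euler f x = 0" if "x \<notin> C" for x
    using that test_function_outside[of x f] Euler_outside[OF f] by (auto simp: C_def)
  have [measurable]: "f \<in> borel_measurable borel" "Euler f \<in> borel_measurable borel"
    using test_function_continuous[OF f] by (auto intro: borel_measurable_continuous_onI)
  note ci = continuous_intros test_function_continuous[OF f] continuous_on_N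
  define g where "g x = (norm (f x))\<^sup>2" for x
  define D where "D x = 2 * (f x \<bullet> Euler f x)" for x
  have gD0: "g x = 0" "D x = 0" if "x \<notin> C" for x using f0[OF that] by (auto simp: g_def D_def)
  have gDc: "continuous_on S g" "continuous_on S D" for S
    unfolding g_def[abs_def] D_def[abs_def] by (auto intro!: ci)
  note gDi = continuous_intros gDc continuous_on_N
  have [measurable]: "g \<in> borel_measurable borel" "D \<in> borel_measurable borel"
    using gDc by (auto intro: borel_measurable_continuous_onI)
  have int: "integrable lborel (\<lambda>x. w x * g x)" "integrable lborel (\<lambda>x. w x * (g x / N x))"
      "integrable lborel (\<lambda>x. w x * (g x / (N x)\<^sup>2))" "integrable lborel (\<lambda>x. w x * (D x / N x))"
      "integrable lborel (\<lambda>x. w x * (D x / (N x)\<^sup>2))" "integrable lborel (\<lambda>x. w x * ((norm (Euler f x))\<^sup>2 / (N x)\<^sup>2))"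
    if "loc_integrable w" for w
    by (rule loc_integrable_mult[OF that C]; auto intro!: gDi ci simp: gD0 f0)+

  have AE0: "AE x in lebesgue. x \<noteq> (0 :: real ^ 'n)"
    by (intro AE_completion AE_lborel_singleton)
  note ae = p(2) q(2) p'(2) q'(2) AE0
  define X1 where "X1 = (LINT x|lborel. (p x)\<^sup>2 * ((norm (Euler f x))\<^sup>2 / (N x)\<^sup>2))"
  define X2 where "X2 = (LINT x|lborel. p x * q x * (D x / N x))"
  define X3 where "X3 = (LINT x|lborel. (q x)\<^sup>2 * g x)"
  define X5 where "X5 = (LINT x|lborel. p x * q x * (g x / N x))"
  define Y1 where "Y1 = (LINT x|lborel. p x * p' x * (D x / N x))"
  define Y2 where "Y2 = (LINT x|lborel. (p x)\<^sup>2 * (D x / (N x)\<^sup>2))"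
  define Y3 where "Y3 = (LINT x|lborel. (p' x)\<^sup>2 * g x)"
  define Y4 where "Y4 = (LINT x|lborel. (p x)\<^sup>2 * (g x / (N x)\<^sup>2))"
  define Y5 where "Y5 = (LINT x|lborel. q x * p' x * g x)"
  define Y6 where "Y6 = (LINT x|lborel. p x * p' x * (g x / N x))"
  define Z where "Z = (LINT x|lborel. p x * q' x * g x)"
  note defs = X1_def X2_def X3_def X5_def Y1_def Y2_def Y3_def Y4_def Y5_def Y6_def Z_def
  have i: "integrable lborel (\<lambda>x. (p x)\<^sup>2 * ((norm (Euler f x))\<^sup>2 / (N x)\<^sup>2))"
    "integrable lborel (\<lambda>x. p x * q x * (D x / N x))"
    "integrable lborel (\<lambda>x. (q x)\<^sup>2 * g x)"
    "integrable lborel (\<lambda>x. p x * q x * (g x / N x))"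
    "integrable lborel (\<lambda>x. p x * p' x * (D x / N x))"
    "integrable lborel (\<lambda>x. (p x)\<^sup>2 * (D x / (N x)\<^sup>2))"
    "integrable lborel (\<lambda>x. (p' x)\<^sup>2 * g x)"
    "integrable lborel (\<lambda>x. (p x)\<^sup>2 * (g x / (N x)\<^sup>2))"
    "integrable lborel (\<lambda>x. q x * p' x * g x)"
    "integrable lborel (\<lambda>x. p x * p' x * (g x / N x))"
    "integrable lborel (\<lambda>x. p x * q' x * g x)"
    by (intro int sq L bm)+
  have PR1: "Y5 + Z + X2 + (Q - 1) * X5 = 0"
  proof -
    have "0 = (LINT x|lborel. ((p' x * q x + p x * q' x) * g x + p x * q x * ((D x + (Q - 1) * g x) / N x)))"
      using weighted_product_rule_complex[OF wp wq f _ _ L(1), of 0] i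
      by (simp add: g_def D_def mult.commute bm)
    also have "\<dots> = (LINT x|lborel. q x * p' x * g x + p x * q' x * g x + p x * q x * (D x / N x) + (Q - 1) * (p x * q x * (g x / N x)))"
      by (intro Bochner_Integration.integral_cong refl) (simp add: algebra_simps add_divide_distrib diff_divide_distrib)
    also have "\<dots> = Y5 + Z + X2 + (Q - 1) * X5"
      using i by (simp add: defs del: times_divide_eq_right times_divide_eq_left)
    finally show ?thesis by simp
  qed
  have PR2: "2 * Y6 + Y2 + (Q - 2) * Y4 = 0"
  proof -
    have "0 = (LINT x|lborel. ((p' x * p x + p x * p' x) * g x + p x * p x * ((D x + (Q - 2) * g x) / N x)) / N x)"
      using weighted_product_rule_complex[OF wp wp f _ _ loc_integrable_mult_L2[OF _ _ sq(1) sq(1)], of 1] int(1)[OF L(2)]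
      by (simp add: g_def D_def mult.commute bm)
    also have "\<dots> = (LINT x|lborel. 2 * (p x * p' x * (g x / N x)) + (p x)\<^sup>2 * (D x / (N x)\<^sup>2) + (Q - 2) * ((p x)\<^sup>2 * (g x / (N x)\<^sup>2)))"
      by (intro Bochner_Integration.integral_cong refl) (simp add: algebra_simps power2_eq_square add_divide_distrib diff_divide_distrib)
    also have "\<dots> = 2 * Y6 + Y2 + (Q - 2) * Y4"
      using i by (simp add: defs del: times_divide_eq_right times_divide_eq_left)
    finally show ?thesis by simp
  qed
  have norm_rad: "(norm (radial_deriv A N f x))\<^sup>2 = (norm (Euler f x))\<^sup>2 / (N x)\<^sup>2" if "x \<noteq> 0" for x
    using radial_deriv_eq_Euler[OF that test_function_differentiable[OF f]]
    by (simp add: power_mult_distrib divide_inverse power_inverse mult.commute)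
  have T1: "(LINT x|lebesgue. (\<phi> x)\<^sup>2 * (norm (radial_deriv A N f x))\<^sup>2) = X1"
    unfolding X1_def by (rule integral_lebesgue_Borel_version) (measurable, use ae in eventually_elim, simp add: norm_rad)
  have T3: "(LINT x|lebesgue. (\<psi> x)\<^sup>2 * (norm (f x))\<^sup>2) = X3"
    unfolding X3_def by (rule integral_lebesgue_Borel_version) (measurable, use ae in eventually_elim, simp add: g_def)
  have T5: "(LINT x|lebesgue. \<phi> x * \<psi> x / N x * (norm (f x))\<^sup>2) = X5"
    unfolding X5_def by (rule integral_lebesgue_Borel_version) (measurable, use ae in eventually_elim, simp add: g_def)
  have T4: "(LINT x|lebesgue. (\<phi> x)\<^sup>2 / (N x)\<^sup>2 * (norm (f x))\<^sup>2) = Y4"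
    unfolding Y4_def by (rule integral_lebesgue_Borel_version) (measurable, use ae in eventually_elim, simp add: g_def)
  have T6: "(LINT x|lebesgue. \<phi> x * R\<phi> x / N x * (norm (f x))\<^sup>2) = Y6"
    unfolding Y6_def by (rule integral_lebesgue_Borel_version) (measurable, use ae in eventually_elim, simp add: g_def)
  have Ts: "(LINT x|lebesgue. (\<phi> x * R\<psi> x + \<psi> x * R\<phi> x) * (norm (f x))\<^sup>2) = Z + Y5"
  proof -
    have "(LINT x|lebesgue. (\<phi> x * R\<psi> x + \<psi> x * R\<phi> x) * (norm (f x))\<^sup>2) = (LINT x|lborel. p x * q' x * g x + q x * p' x * g x)"
      by (rule integral_lebesgue_Borel_version) (measurable, use ae in eventually_elim, simp add: g_def distrib_right)
    then show ?thesis using i by (simp add: defs del: times_divide_eq_right times_divide_eq_left)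
  qed
  have Td: "(LINT x|lebesgue. (\<psi> x * R\<phi> x - \<phi> x * R\<psi> x) * (norm (f x))\<^sup>2) = Y5 - Z"
  proof -
    have "(LINT x|lebesgue. (\<psi> x * R\<phi> x - \<phi> x * R\<psi> x) * (norm (f x))\<^sup>2) = (LINT x|lborel. q x * p' x * g x - p x * q' x * g x)"
      by (rule integral_lebesgue_Borel_version) (measurable, use ae in eventually_elim, simp add: g_def left_diff_distrib)
    then show ?thesis using i by (simp add: defs del: times_divide_eq_right times_divide_eq_left)
  qed
  have square: "0 \<le> a\<^sup>2 * ((norm (Euler f x))\<^sup>2 / (N x)\<^sup>2) + a * b * (D x / N x) + b\<^sup>2 * g x" for a b x
  proof -
    have "0 \<le> (norm ((a / N x) *\<^sub>R Euler f x + b *\<^sub>R f x))\<^sup>2" by simp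
    also have "\<dots> = a\<^sup>2 * ((norm (Euler f x))\<^sup>2 / (N x)\<^sup>2) + a * b * (D x / N x) + b\<^sup>2 * g x"
      unfolding g_def D_def power2_norm_eq_inner
      by (simp add: inner_add_left inner_add_right inner_commute power2_eq_square algebra_simps)
    finally show ?thesis .
  qed
  have "0 \<le> (LINT x|lborel. (p x)\<^sup>2 * ((norm (Euler f x))\<^sup>2 / (N x)\<^sup>2) + \<alpha> * (p x * q x * (D x / N x)) + \<alpha>\<^sup>2 * ((q x)\<^sup>2 * g x))"
    by (intro Bochner_Integration.integral_nonneg) (use square[of "p _" _ "\<alpha> * q _"] in \<open>simp add: power_mult_distrib mult_ac\<close>)
  also have "\<dots> = X1 + \<alpha> * X2 + \<alpha>\<^sup>2 * X3" using i by (simp add: defs del: times_divide_eq_right times_divide_eq_left)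
  finally have S1: "0 \<le> X1 + \<alpha> * X2 + \<alpha>\<^sup>2 * X3" .
  have X2: "X2 = - Y5 - Z - (Q - 1) * X5" using PR1 by linarith
  show ?first
    unfolding T1 T3 T5 Ts using S1 unfolding X2 by (simp add: algebra_simps)
  have "0 \<le> (LINT x|lborel. (p x)\<^sup>2 * ((norm (Euler f x))\<^sup>2 / (N x)\<^sup>2)
      - \<alpha> * (p x * q x * (D x / N x)) + p x * p' x * (D x / N x) + (Q - 1) * ((p x)\<^sup>2 * (D x / (N x)\<^sup>2))
      + \<alpha>\<^sup>2 * ((q x)\<^sup>2 * g x) + (p' x)\<^sup>2 * g x + (Q - 1)\<^sup>2 * ((p x)\<^sup>2 * (g x / (N x)\<^sup>2))
      - 2 * \<alpha> * (q x * p' x * g x) - 2 * \<alpha> * (Q - 1) * (p x * q x * (g x / N x)) + 2 * (Q - 1) * (p x * p' x * (g x / N x)))"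
  proof (intro Bochner_Integration.integral_nonneg)
    fix x
    \<comment> \<open>The integrand is the squared modulus of \<open>\<phi> Rf + k f\<close>, with \<open>- k f - \<phi> Rf\<close> the adjoint of \<open>\<phi> R + \<alpha> \<psi>\<close>.\<close>
    define k where "k = - (\<alpha> * q x - p' x - (Q - 1) * (p x / N x))"
    have "0 \<le> (p x)\<^sup>2 * ((norm (Euler f x))\<^sup>2 / (N x)\<^sup>2) + p x * k * (D x / N x) + k\<^sup>2 * g x" by (rule square)
    also have "\<dots> = (p x)\<^sup>2 * ((norm (Euler f x))\<^sup>2 / (N x)\<^sup>2)
      - \<alpha> * (p x * q x * (D x / N x)) + p x * p' x * (D x / N x) + (Q - 1) * ((p x)\<^sup>2 * (D x / (N x)\<^sup>2))
      + \<alpha>\<^sup>2 * ((q x)\<^sup>2 * g x) + (p' x)\<^sup>2 * g x + (Q - 1)\<^sup>2 * ((p x)\<^sup>2 * (g x / (N x)\<^sup>2))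
      - 2 * \<alpha> * (q x * p' x * g x) - 2 * \<alpha> * (Q - 1) * (p x * q x * (g x / N x)) + 2 * (Q - 1) * (p x * p' x * (g x / N x))"
      unfolding k_def divide_inverse power_inverse[symmetric] by algebra
    finally show "0 \<le> \<dots>" .
  qed
  also have "\<dots> = X1 - \<alpha> * X2 + Y1 + (Q - 1) * Y2 + \<alpha>\<^sup>2 * X3 + Y3 + (Q - 1)\<^sup>2 * Y4 - 2 * \<alpha> * Y5 - 2 * \<alpha> * (Q - 1) * X5 + 2 * (Q - 1) * Y6"
    using i by (simp add: defs del: times_divide_eq_right times_divide_eq_left)
  finally have S2: "0 \<le> X1 - \<alpha> * X2 + Y1 + (Q - 1) * Y2 + \<alpha>\<^sup>2 * X3 + Y3 + (Q - 1)\<^sup>2 * Y4 - 2 * \<alpha> * Y5 - 2 * \<alpha> * (Q - 1) * X5 + 2 * (Q - 1) * Y6" .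
  \<comment> \<open>Both branches of the definition of the pairing have this value: by the product rule for
    \<open>\<phi>\<close> and \<open>R\<phi>\<close> if \<open>R\<phi>\<close> has a suitable weak derivative, and otherwise by definition.\<close>
  have pairing: "radial_pairing A N \<phi> R\<phi> R\<phi> (\<lambda>x. (norm (f x))\<^sup>2) = - Y1 - (Q - 1) * Y6 - Y3"
  proof -
    define P where "P = (\<lambda>Rv. has_weak_radial_deriv A N R\<phi> Rv \<and> integrable lebesgue (\<lambda>x. \<phi> x * Rv x * (norm (f x))\<^sup>2))"
    show ?thesis
    proof (cases "\<exists>Rv. P Rv")
      case True
      define Rv where "Rv = (SOME Rv. P Rv)"
      have "P Rv" unfolding Rv_def using True by (rule someI_ex)
      then have Rv: "has_weak_radial_deriv A N R\<phi> Rv" "integrable lebesgue (\<lambda>x. \<phi> x * Rv x * (norm (f x))\<^sup>2)"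
        by (auto simp: P_def)
      obtain r where r: "loc_integrable r" "AE x in lebesgue. Rv x = r x"
        using L1_loc_Borel_version Rv(1) by (auto simp: has_weak_radial_deriv_def)
      have [measurable]: "r \<in> borel_measurable borel" using r by (simp add: loc_integrable_def)
      have wr: "weak_deriv p' r" using has_weak_radial_deriv_Borel[OF Rv(1) p' r] .
      have rm: "(\<lambda>x. p x * r x * g x) \<in> borel_measurable borel" by measurable
      have "integrable lebesgue (\<lambda>x. p x * r x * g x)"
        using Rv(2)
      proof (rule integrable_cong_AE_imp)
        show "(\<lambda>x. p x * r x * g x) \<in> borel_measurable lebesgue"
          using rm by (intro measurable_completion) simp
        show "AE x in lebesgue. \<phi> x * Rv x * (norm (f x))\<^sup>2 = p x * r x * g x"
          using ae r(2) by eventually_elim (simp add: g_def)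
      qed
      then have ri: "integrable lborel (\<lambda>x. p x * r x * g x)"
        using rm by (subst (asm) integrable_completion) auto
      have "0 = (LINT x|lborel. (p' x * p' x + p x * r x) * g x + p x * p' x * ((D x + (Q - 1) * g x) / N x))"
        using weighted_product_rule_complex[OF wp wr f _ _ L(2), of 0] ri i(7)
        by (simp add: g_def D_def bm power2_eq_square)
      also have "\<dots> = (LINT x|lborel. (p' x)\<^sup>2 * g x + p x * r x * g x + p x * p' x * (D x / N x) + (Q - 1) * (p x * p' x * (g x / N x)))"
        by (intro Bochner_Integration.integral_cong refl) (simp add: algebra_simps power2_eq_square add_divide_distrib diff_divide_distrib)
      also have "\<dots> = Y3 + (LINT x|lborel. p x * r x * g x) + Y1 + (Q - 1) * Y6"
        using i ri by (simp add: defs del: times_divide_eq_right times_divide_eq_left)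
      finally have "(LINT x|lborel. p x * r x * g x) = - Y1 - (Q - 1) * Y6 - Y3" by simp
      moreover have "(LINT x|lebesgue. \<phi> x * Rv x * (norm (f x))\<^sup>2) = (LINT x|lborel. p x * r x * g x)"
        by (rule integral_lebesgue_Borel_version[OF rm]) (use ae r(2) in eventually_elim, simp add: g_def)
      moreover have "radial_pairing A N \<phi> R\<phi> R\<phi> (\<lambda>x. (norm (f x))\<^sup>2) = (LINT x|lebesgue. \<phi> x * Rv x * (norm (f x))\<^sup>2)"
        using True unfolding radial_pairing_def Let_def P_def[symmetric] Rv_def by simp
      ultimately show ?thesis by simp
    next
      case False
      have "(LINT x|lebesgue. \<phi> x * R\<phi> x * radial_adjoint A N (\<lambda>x. (norm (f x))\<^sup>2) x)
        = (LINT x|lborel. - (p x * p' x * (D x / N x)) - (Q - 1) * (p x * p' x * (g x / N x)))"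
        by (rule integral_lebesgue_Borel_version)
          (measurable, use ae in eventually_elim,
            simp add: g_def D_def radial_adjoint_norm_square[OF test_function_differentiable[OF f]] algebra_simps)
      also have "\<dots> = - Y1 - (Q - 1) * Y6" using i by (simp add: defs del: times_divide_eq_right times_divide_eq_left)
      finally have "(LINT x|lebesgue. \<phi> x * R\<phi> x * radial_adjoint A N (\<lambda>x. (norm (f x))\<^sup>2) x) = - Y1 - (Q - 1) * Y6" .
      moreover have "(LINT x|lebesgue. R\<phi> x * R\<phi> x * (norm (f x))\<^sup>2) = Y3"
        unfolding Y3_def by (rule integral_lebesgue_Borel_version)
          (measurable, use ae in eventually_elim, simp add: g_def power2_eq_square)
      moreover have "radial_pairing A N \<phi> R\<phi> R\<phi> (\<lambda>x. (norm (f x))\<^sup>2)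
        = (LINT x|lebesgue. \<phi> x * R\<phi> x * radial_adjoint A N (\<lambda>x. (norm (f x))\<^sup>2) x) - (LINT x|lebesgue. R\<phi> x * R\<phi> x * (norm (f x))\<^sup>2)"
        unfolding radial_pairing_def Let_def P_def[symmetric] by (rule if_not_P[OF False])
      ultimately show ?thesis by simp
    qed
  qed
  have Y2: "Y2 = - 2 * Y6 - (Q - 2) * Y4" using PR2 by linarith
  show ?second
    unfolding T1 T3 T4 T5 T6 Td pairing using S2 unfolding X2 Y2 by (simp add: algebra_simps power2_eq_square)
qed

end

theorem theorem3p1:
  fixes G :: "(real ^ 'n::finite) monoid"
    and A :: "real ^ 'n \<Rightarrow> real ^ 'n"
    and N :: "real ^ 'n \<Rightarrow> real"
    and \<phi> \<psi> R\<phi> R\<psi> :: "real ^ 'n \<Rightarrow> real"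
    and \<alpha> Q :: real
    and f :: "real ^ 'n \<Rightarrow> complex"
  assumes "homogeneous_group G A"
    and "Q = homogeneous_dim A" and "Q \<ge> 3"
    and "homogeneous_quasi_norm G A N"
    and "L2_loc \<phi>" and "L2_loc \<psi>"
    and "has_weak_radial_deriv A N \<phi> R\<phi>" and "has_weak_radial_deriv A N \<psi> R\<psi>"
    and "L2_loc R\<phi>" and "L2_loc R\<psi>"
    and "test_function f"
  shows "((LINT x|lebesgue. (\<phi> x)\<^sup>2 * (norm (radial_deriv A N f x))\<^sup>2)
      \<ge> \<alpha> * (LINT x|lebesgue. (\<phi> x * R\<psi> x + \<psi> x * R\<phi> x) * (norm (f x))\<^sup>2)
        + \<alpha> * (Q - 1) * (LINT x|lebesgue. \<phi> x * \<psi> x / N x * (norm (f x))\<^sup>2)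
        - \<alpha>\<^sup>2 * (LINT x|lebesgue. (\<psi> x)\<^sup>2 * (norm (f x))\<^sup>2))
    \<and> ((LINT x|lebesgue. (\<phi> x)\<^sup>2 * (norm (radial_deriv A N f x))\<^sup>2)
      \<ge> \<alpha> * (LINT x|lebesgue. (\<psi> x * R\<phi> x - \<phi> x * R\<psi> x) * (norm (f x))\<^sup>2)
        + \<alpha> * (Q - 1) * (LINT x|lebesgue. \<phi> x * \<psi> x / N x * (norm (f x))\<^sup>2)
        - \<alpha>\<^sup>2 * (LINT x|lebesgue. (\<psi> x)\<^sup>2 * (norm (f x))\<^sup>2)
        - (Q - 1) * (LINT x|lebesgue. (\<phi> x)\<^sup>2 / (N x)\<^sup>2 * (norm (f x))\<^sup>2)
        + (Q - 1) * (LINT x|lebesgue. \<phi> x * R\<phi> x / N x * (norm (f x))\<^sup>2)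
        + radial_pairing A N \<phi> R\<phi> R\<phi> (\<lambda>x. (norm (f x))\<^sup>2))"
proof -
  interpret homogeneous_group G A by fact
  interpret quasi_norm_flow A N
    using assms(4) linear diagonalisable_positive
    by (intro quasi_norm_flow.intro dilation_flow.intro quasi_norm_flow_axioms.intro)
      (auto simp: homogeneous_quasi_norm_def)
  show ?thesis
    unfolding assms(2)
    using radial_inequalities[OF assms(5,6,9,10,7,8,11), of \<alpha>] by blast
qed

end
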